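(* Let $g(x)=\dfrac{x^2-1}{(x^2+1)(x^2+4)(x^2+9)}$ for $x\in\mathbb{R}$. Let $a_*\in\left(\frac13,\frac12\right)$ be the unique solution $x=a_*$ in $\left(\frac13,\frac12\right)$ of $$\frac{2e^{-2\pi(1/x-2)}}{(1-e^{-2\pi/x})(1-e^{-2\pi})^2}=1.$$ Then, for all $\alpha,\beta>0$ with $\beta\ge 1$ and $\frac13\le\alpha\beta<a_*$, the Gabor system $\mathcal G(g,\alpha,\beta)$ is a frame for $L^2(\mathbb{R})$.
   Context: For $g\in L^2(\mathbb{R})$ nonzero and $\alpha,\beta>0$, the Gabor system is $\mathcal G(g,\alpha,\beta)=\{x\mapsto e^{2\pi i\beta m x}g(x-\alpha k): k,m\in\mathbb{Z}\}$. It is a (Gabor) frame for $L^2(\mathbb{R})$ if there exist constants $A,B>0$ such that for every $f\in L^2(\mathbb{R})$, $A\|f\|^2\le\sum_{m,k\in\mathbb{Z}}|\langle f,e^{2\pi i\beta m\cdot}g(\cdot-\alpha k)\rangle|^2\le B\|f\|^2$. *)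

theory Defs
  imports "HOL-Analysis.Analysis"
begin

text \<open>
  Elements of \<open>L\<^sup>2(\<real>)\<close> are represented by square-integrable complex-valued Borel functions:
  every almost-everywhere class has such a representative, and the norm and the inner product
  below depend only on the class.
\<close>

definition L2 :: "(real \<Rightarrow> complex) set" where
  "L2 = {f \<in> borel_measurable lborel. integrable lborel (\<lambda>x. (cmod (f x))\<^sup>2)}"

definition L2_norm :: "(real \<Rightarrow> complex) \<Rightarrow> real" where
  "L2_norm f = sqrt (LINT x|lborel. (cmod (f x))\<^sup>2)"

definition L2_inner :: "(real \<Rightarrow> complex) \<Rightarrow> (real \<Rightarrow> complex) \<Rightarrow> complex" where
  "L2_inner f h = (LINT x|lborel. f x * cnj (h x))"

definition gabor_system ::
    "(real \<Rightarrow> complex) \<Rightarrow> real \<Rightarrow> real \<Rightarrow> int \<times> int \<Rightarrow> real \<Rightarrow> complex" where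
  "gabor_system g \<alpha> \<beta> = (\<lambda>(m, k) x. cis (2 * pi * \<beta> * of_int m * x) * g (x - \<alpha> * of_int k))"

text \<open>
  A finite upper frame bound includes the convergence of the series; it is stated separately
  because \<open>infsum\<close> is 0 for families that are not summable. Membership of the family in
  \<open>L\<^sup>2(\<real>)\<close> is required so that the inner products are genuine (non-integrable integrands
  would give 0).
\<close>

definition L2_frame :: "('i \<Rightarrow> real \<Rightarrow> complex) \<Rightarrow> bool" where
  "L2_frame e \<longleftrightarrow>
     (\<forall>i. e i \<in> L2) \<and>
     (\<exists>A>0. \<exists>B>0. \<forall>f\<in>L2.
        (\<lambda>i. (cmod (L2_inner f (e i)))\<^sup>2) summable_on UNIV \<and>
        A * (L2_norm f)\<^sup>2 \<le> (\<Sum>\<^sub>\<infinity>i. (cmod (L2_inner f (e i)))\<^sup>2) \<and>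
        (\<Sum>\<^sub>\<infinity>i. (cmod (L2_inner f (e i)))\<^sup>2) \<le> B * (L2_norm f)\<^sup>2)"

definition window :: "real \<Rightarrow> complex" where
  "window x = of_real ((x\<^sup>2 - 1) / ((x\<^sup>2 + 1) * (x\<^sup>2 + 4) * (x\<^sup>2 + 9)))"

definition critical_eq :: "real \<Rightarrow> bool" where
  "critical_eq x \<longleftrightarrow>
     2 * exp (- 2 * pi * (1 / x - 2)) /
       ((1 - exp (- 2 * pi / x)) * (1 - exp (- 2 * pi))\<^sup>2) = 1"

definition a_star :: real where
  "a_star = (THE x. x \<in> {1/3<..<1/2} \<and> critical_eq x)"

end

theory Submission
  imports Defs
begin

text \<open>
  The Fourier transform of the window is, up to the factor \<open>- pi / 12\<close>, the function
  \<open>H \<xi> = u * (1 - u)\<^sup>2\<close> with \<open>u = exp (- 2 * pi * \<bar>\<xi>\<bar>)\<close>. It has one sign, vanishes at the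
  origin, and for \<open>\<bar>\<xi>\<bar> \<le> \<beta>\<close> its translates by nonzero multiples of \<open>1 / \<alpha>\<close> are tiny. The frame
  property follows from diagonal dominance on the frequency side, as follows.

  Summing over the modulations with Parseval's identity turns the frame sum for \<open>f\<close> into an integral
  over \<open>x\<close> in a period of length \<open>1 / \<beta>\<close> of the sum over \<open>k\<close> of the squared moduli of
  \<open>\<Sum>j. f (x + j / \<beta>) * cnj (g (x + j / \<beta> - \<alpha> * k))\<close>.
  So it suffices to compare, uniformly in \<open>x\<close>, such sums over \<open>k\<close> with the sum over \<open>j\<close> of the
  squared moduli of the samples \<open>c j\<close> (\<open>fiber_bounds\<close>). Let \<open>C\<close> be the trigonometric sum with
  frequencies \<open>x + j / \<beta>\<close> and coefficients \<open>c j\<close>; its modulus has period \<open>\<beta>\<close> and its energy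
  over a period is \<open>\<beta>\<close> times the energy of the samples. By Parseval's identity again, the sum over
  \<open>k\<close> is \<open>1 / \<alpha>\<close> times the energy of the periodization of \<open>G * C\<close> with period \<open>1 / \<alpha>\<close>,
  where \<open>G\<close> is the Fourier transform of \<open>g\<close>.

  The lower bound uses only the frequencies with \<open>\<beta> / 2 \<le> \<bar>\<xi>\<bar> \<le> \<beta>\<close>
  (\<open>fiber_lower\<close>). This annulus is a fundamental domain modulo \<open>\<beta>\<close>, so \<open>C\<close> has the same energy
  on each of its translates. It avoids the zero of \<open>H\<close>: since \<open>u * (1 - u)\<^sup>2\<close> is increasing for
  small \<open>u\<close>, the minimum of \<open>H\<close> on the annulus is
  \<open>exp (- 2 * pi * \<beta>) * (1 - exp (- 2 * pi * \<beta>))\<^sup>2\<close>. The translates of \<open>H\<close> by \<open>l / \<alpha>\<close> with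
  \<open>l \<noteq> 0\<close> are at most \<open>exp (- 2 * pi * (\<bar>l\<bar> / \<alpha> - \<beta>))\<close> there, with sum
  \<open>2 * exp (2 * pi * \<beta>) * exp (- 2 * pi / \<alpha>) / (1 - exp (- 2 * pi / \<alpha>))\<close>. The main term wins when
  this sum is smaller than the minimum. For \<open>\<beta> = 1\<close> the quotient of the two is precisely the left-hand
  side of the equation defining \<open>a_star\<close> at \<open>\<alpha> * \<beta>\<close>, and for fixed \<open>\<alpha> * \<beta>\<close> it decreases
  with \<open>\<beta>\<close> (\<open>spectrum_dominant\<close>). That left-hand side is strictly increasing, which gives both
  the uniqueness of \<open>a_star\<close> and the range of admissible parameters.

  The computation is carried out for continuous \<open>f\<close> of compact support, where all sums over \<open>j\<close> are
  finite, and extends by density (\<open>L2_frame_by_density\<close>).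
\<close>

section \<open>Parseval's identity for continuous periodic functions\<close>

text \<open>
  On the unit circle the conjugate of \<open>z\<close> is \<open>1 / z\<close>, so a polynomial in the real and the
  imaginary part of \<open>z\<close> is a Laurent polynomial in \<open>z\<close>. Multiplying by a power of \<open>z\<close> keeps the
  argument inside ordinary polynomials.
\<close>

lemma real_polynomial_on_circle:
  fixes f :: "complex \<Rightarrow> real"
  assumes "real_polynomial_function f"
  shows "\<exists>n p. \<forall>z. cmod z = 1 \<longrightarrow> of_real (f z) * z ^ n = poly p z"
  using assms
proof (induction f rule: real_polynomial_function.induct)
  case (linear f)
  have cnj_mult: "cnj z * z = 1" if "cmod z = 1" for z
    using that complex_norm_square[of z] by (simp add: mult.commute)
  have "of_real (f z) * z ^ 1 = poly [:(f 1 + \<i> * f \<i>) / 2, 0, (f 1 - \<i> * f \<i>) / 2:] z"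
    if z: "cmod z = 1" for z
  proof -
    have "f z = f (Re z *\<^sub>R 1 + Im z *\<^sub>R \<i>)"
      by (rule arg_cong[where f = f]) (simp add: complex_eq_iff)
    also have "\<dots> = Re z * f 1 + Im z * f \<i>"
      using linear by (simp add: linear_simps bounded_linear.linear linear_add linear_cmul)
    finally have fz: "f z = Re z * f 1 + Im z * f \<i>" .
    have "of_real (f z) = (z + cnj z) / 2 * f 1 - \<i> * (z - cnj z) / 2 * f \<i>"
      unfolding fz by (simp add: complex_eq_iff)
    from arg_cong[OF this, of "\<lambda>w. w * z"] have "of_real (f z) * z
        = (z * z + cnj z * z) / 2 * f 1 - \<i> * (z * z - cnj z * z) / 2 * f \<i>"
      by (simp only: ring_distribs times_divide_eq_left times_divide_eq_right mult_ac
          left_diff_distrib right_diff_distrib diff_divide_distrib add_divide_distrib)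
    then show ?thesis
      unfolding cnj_mult[OF z] by (simp add: field_simps)
  qed
  then show ?case by blast
next
  case (const c)
  have "\<forall>z. cmod z = 1 \<longrightarrow> of_real c * z ^ 0 = poly [:of_real c:] z" by simp
  then show ?case by blast
next
  case (add f g)
  then obtain n p n' p' where
      p: "\<And>z. cmod z = 1 \<Longrightarrow> of_real (f z) * z ^ n = poly p z"
    and p': "\<And>z. cmod z = 1 \<Longrightarrow> of_real (g z) * z ^ n' = poly p' z"
    by blast
  have "of_real (f z + g z) * z ^ (n + n') = poly (p * monom 1 n' + p' * monom 1 n) z"
    if "cmod z = 1" for z
    using p[OF that, symmetric] p'[OF that, symmetric]
    by (simp add: poly_monom power_add algebra_simps)
  then show ?case by blast
next
  case (mult f g)
  then obtain n p n' p' where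
      p: "\<And>z. cmod z = 1 \<Longrightarrow> of_real (f z) * z ^ n = poly p z"
    and p': "\<And>z. cmod z = 1 \<Longrightarrow> of_real (g z) * z ^ n' = poly p' z"
    by blast
  have "of_real (f z * g z) * z ^ (n + n') = poly (p * p') z" if "cmod z = 1" for z
    using p[OF that, symmetric] p'[OF that, symmetric]
    by (simp add: power_add algebra_simps)
  then show ?case by blast
qed

lemma polynomial_on_circle:
  fixes f :: "complex \<Rightarrow> complex"
  assumes "polynomial_function f"
  shows "\<exists>n p. \<forall>z. cmod z = 1 \<longrightarrow> f z * z ^ n = poly p z"
proof -
  have "real_polynomial_function (\<lambda>z. Re (f z))" "real_polynomial_function (\<lambda>z. Im (f z))"
    using assms bounded_linear_Re bounded_linear_Im
    unfolding polynomial_function_def o_def by blast+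
  then obtain n p n' p' where
      p: "\<And>z. cmod z = 1 \<Longrightarrow> of_real (Re (f z)) * z ^ n = poly p z"
    and p': "\<And>z. cmod z = 1 \<Longrightarrow> of_real (Im (f z)) * z ^ n' = poly p' z"
    using real_polynomial_on_circle by meson
  have "f z * z ^ (n + n') = poly (p * monom 1 n' + smult \<i> (p' * monom 1 n)) z"
    if "cmod z = 1" for z
  proof -
    have "f z * z ^ (n + n')
        = (of_real (Re (f z)) * z ^ n) * z ^ n' + \<i> * ((of_real (Im (f z)) * z ^ n') * z ^ n)"
      by (subst complex_eq[of "f z"]) (simp add: power_add algebra_simps)
    then show ?thesis
      using p[OF that] p'[OF that] by (simp add: poly_monom)
  qed
  then show ?thesis by blast
qed

text \<open>
  Wrapping the period around the unit circle turns \<open>u\<close> into a continuous function there. Stone and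
  Weierstrass provide a polynomial in two real variables close to it, which on the circle is a
  trigonometric polynomial.
\<close>

lemma trigonometric_approximation:
  fixes u :: "real \<Rightarrow> complex"
  assumes P: "P > 0" and cont: "continuous_on {a..a + P} u" and per: "u (a + P) = u a"
    and e: "e > 0"
  shows "\<exists>F c. finite F \<and>
    (\<forall>x\<in>{a..a + P}. cmod (u x - (\<Sum>m\<in>F. c m * cis (2 * pi * of_int m * x / P))) < e)"
proof -
  define p where "p = (\<lambda>t. u (a + t * P))"
  define U where "U = p \<circ> (\<lambda>z. Arg2pi z / (2 * pi))"
  \<comment> \<open>Continuity of the wrapped function is the passage from a closed path to a circle map.\<close>
  have path: "path p"
    unfolding path_def p_def using P
    by (intro continuous_intros continuous_on_compose2[OF cont]) (auto simp: mult_le_cancel_right1)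
  have "pathfinish p = pathstart p"
    using per by (simp add: p_def pathfinish_def pathstart_def)
  then have "homotopic_loops UNIV p p"
    using path by (simp add: homotopic_loops_refl)
  then have U: "continuous_on (sphere 0 1) U"
    unfolding U_def
    using homotopic_loops_imp_homotopic_circlemaps homotopic_with_imp_continuous by blast
  have U_cis: "U (cis (2 * pi * (x - a) / P)) = u x" if x: "x \<in> {a..a + P}" for x
  proof (cases "x = a + P")
    case True
    have "Arg2pi 1 = 0" by (simp add: Arg2pi_eq_0)
    then show ?thesis using True P per by (simp add: U_def p_def)
  next
    case False
    have "(x - a) / P < 1" using x False P by simp
    then have "2 * pi * ((x - a) / P) < 2 * pi * 1"
      by (intro mult_strict_left_mono) auto
    then have "Arg2pi (cis (2 * pi * (x - a) / P)) = 2 * pi * (x - a) / P"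
      by (intro Arg2pi_unique[of 1]) (use x P in \<open>auto simp: cis_conv_exp\<close>)
    then show ?thesis using P by (simp add: U_def p_def)
  qed
  obtain g where g: "polynomial_function g" "\<And>z. z \<in> sphere 0 1 \<Longrightarrow> norm (U z - g z) < e"
    using Stone_Weierstrass_polynomial_function[OF compact_sphere U e] by blast
  obtain n q where q: "\<And>z. cmod z = 1 \<Longrightarrow> g z * z ^ n = poly q z"
    using polynomial_on_circle[OF g(1)] by blast
  define F where "F = (\<lambda>i. int i - int n) ` {..degree q}"
  define c where "c = (\<lambda>m. coeff q (nat (m + int n)) * cis (- 2 * pi * of_int m * a / P))"
  have "cmod (u x - (\<Sum>m\<in>F. c m * cis (2 * pi * of_int m * x / P))) < e"
    if x: "x \<in> {a..a + P}" for x
  proof -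
    define t where "t = 2 * pi * (x - a) / P"
    have pow: "cis (2 * pi * of_int (int i - int n) * x / P)
        * cis (- 2 * pi * of_int (int i - int n) * a / P) * cis t ^ n = cis t ^ i" for i
      unfolding t_def Complex.DeMoivre cis_mult
      by (rule arg_cong[where f = cis]) (use P in \<open>simp add: field_simps\<close>)
    have "g (cis t) * cis t ^ n = poly q (cis t)"
      by (rule q) simp
    also have "\<dots> = (\<Sum>i\<le>degree q. coeff q i * cis t ^ i)"
      by (rule poly_altdef)
    also have "\<dots> = (\<Sum>i\<le>degree q. c (int i - int n)
        * cis (2 * pi * of_int (int i - int n) * x / P)) * cis t ^ n"
      unfolding sum_distrib_right
      by (intro sum.cong refl, subst pow[symmetric]) (simp add: c_def mult_ac)
    also have "(\<Sum>i\<le>degree q. c (int i - int n) * cis (2 * pi * of_int (int i - int n) * x / P))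
        = (\<Sum>m\<in>F. c m * cis (2 * pi * of_int m * x / P))"
      unfolding F_def by (subst sum.reindex) (auto simp: inj_on_def)
    finally have "g (cis t) = (\<Sum>m\<in>F. c m * cis (2 * pi * of_int m * x / P))"
      by simp
    moreover have "cmod (U (cis t) - g (cis t)) < e"
      by (rule g) simp
    ultimately show ?thesis
      using U_cis[OF x] by (simp add: t_def)
  qed
  then show ?thesis
    by (intro exI[of _ F] exI[of _ c]) (auto simp: F_def)
qed

lemma cis_has_integral_period:
  assumes P: "P > 0"
  shows "((\<lambda>x. cis (2 * pi * of_int m * x / P)) has_integral (if m = 0 then of_real P else 0)) {a..a + P}"
proof (cases "m = 0")
  case True
  have "((\<lambda>x::real. 1::complex) has_integral (P *\<^sub>R 1)) {a..a + P}"
    using has_integral_const_real[of "1::complex" a "a + P"] P by simp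
  then show ?thesis using True by (simp add: scaleR_conv_of_real)
next
  case False
  define k where "k = 2 * pi * of_int m / P"
  have k: "k \<noteq> 0" using False P by (simp add: k_def)
  have "((\<lambda>x. cis (k * x)) has_integral
      (cis (k * (a + P)) / (\<i> * k) - cis (k * a) / (\<i> * k))) {a..a + P}"
    by (rule fundamental_theorem_of_calculus)
      (use P k in \<open>auto intro!: derivative_eq_intros
        simp: has_vector_derivative_def fun_eq_iff scaleR_conv_of_real complex_eq_iff\<close>)
  moreover have "cis (k * (a + P)) = cis (k * a)"
  proof -
    have "k * (a + P) = k * a + 2 * pi * of_int m"
      using P by (simp add: k_def field_simps)
    then show ?thesis by (simp flip: cis_mult)
  qed
  ultimately show ?thesis
    using False by (simp add: k_def mult_ac)
qed

text \<open>
  Completing the square: the distance from \<open>u\<close> to a trigonometric polynomial is minimal when the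
  coefficients are those of \<open>u\<close>. The identity contains Bessel's inequality (insert the Fourier
  coefficients) and bounds the defect in it by the distance to any trigonometric polynomial.
\<close>

lemma integral_cmod_diff_trigonometric:
  fixes u :: "real \<Rightarrow> complex"
  assumes P: "P > 0" and cont: "continuous_on {a..a + P} u" and F: "finite F"
  defines "b \<equiv> \<lambda>m. integral {a..a + P} (\<lambda>x. u x * cis (- 2 * pi * of_int m * x / P))"
  shows "integral {a..a + P} (\<lambda>x. (cmod (u x - (\<Sum>m\<in>F. c m * cis (2 * pi * of_int m * x / P))))\<^sup>2)
    = integral {a..a + P} (\<lambda>x. (cmod (u x))\<^sup>2) - (\<Sum>m\<in>F. (cmod (b m))\<^sup>2) / P
      + (\<Sum>m\<in>F. (cmod (b m - P * c m))\<^sup>2) / P"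
proof -
  define e where "e = (\<lambda>m x. cis (2 * pi * of_int m * x / P))"
  define S where "S = (\<lambda>x. \<Sum>m\<in>F. c m * e m x)"
  have cont_e [continuous_intros]: "continuous_on {a..a + P} (e m)" for m
    unfolding e_def by (intro continuous_intros) (use P in auto)
  have cnj_e: "cnj (e m x) = cis (- 2 * pi * of_int m * x / P)" for m x
    by (simp add: e_def cis_cnj)
  have orth: "((\<lambda>x. e m x * cnj (e m' x)) has_integral (if m = m' then of_real P else 0)) {a..a + P}" for m m'
  proof -
    have "e m x * cnj (e m' x) = cis (2 * pi * of_int (m - m') * x / P)" for x
      unfolding e_def cis_cnj cis_mult using P by (auto intro!: arg_cong[where f = cis] simp: field_simps)
    then show ?thesis using cis_has_integral_period[OF P, of "m - m'" a] by simp
  qed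
  have b: "((\<lambda>x. u x * cnj (e m x)) has_integral b m) {a..a + P}" for m
    unfolding b_def cnj_e[symmetric]
    by (intro integrable_integral integrable_continuous_interval continuous_intros cont)
  have uS: "((\<lambda>x. u x * cnj (S x)) has_integral (\<Sum>m\<in>F. cnj (c m) * b m)) {a..a + P}"
  proof -
    have "((\<lambda>x. \<Sum>m\<in>F. cnj (c m) * (u x * cnj (e m x))) has_integral (\<Sum>m\<in>F. cnj (c m) * b m)) {a..a + P}"
      by (intro has_integral_sum F has_integral_mult_right b)
    then show ?thesis by (simp add: S_def sum_distrib_left mult_ac)
  qed
  have SS: "((\<lambda>x. S x * cnj (S x)) has_integral (\<Sum>m\<in>F. c m * cnj (c m) * P)) {a..a + P}"
  proof -
    have "((\<lambda>x. \<Sum>m\<in>F. \<Sum>m'\<in>F. c m * cnj (c m') * (e m x * cnj (e m' x)))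
       has_integral (\<Sum>m\<in>F. \<Sum>m'\<in>F. c m * cnj (c m') * (if m = m' then of_real P else 0))) {a..a + P}"
      by (intro has_integral_sum F has_integral_mult_right orth)
    moreover have "(\<Sum>m\<in>F. \<Sum>m'\<in>F. c m * cnj (c m') * (if m = m' then of_real P else 0))
        = (\<Sum>m\<in>F. c m * cnj (c m) * of_real P)"
      using F by (intro sum.cong refl) (simp add: sum.delta' if_distrib cong: if_cong)
    moreover have "S x * cnj (S x) = (\<Sum>m\<in>F. \<Sum>m'\<in>F. c m * cnj (c m') * (e m x * cnj (e m' x)))" for x
      by (simp add: S_def sum_product mult_ac)
    ultimately show ?thesis by simp
  qed
  have re: "((\<lambda>x. Re (w x)) has_integral Re I) {a..a + P}" if "(w has_integral I) {a..a + P}" for w I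
    using has_integral_linear[OF that bounded_linear_Re] by (simp add: o_def)
  have int_u: "((\<lambda>x. (cmod (u x))\<^sup>2) has_integral integral {a..a + P} (\<lambda>x. (cmod (u x))\<^sup>2)) {a..a + P}"
    by (intro integrable_integral integrable_continuous_interval continuous_intros cont)
  have "(cmod (u x - S x))\<^sup>2 = (cmod (u x))\<^sup>2 - 2 * Re (u x * cnj (S x)) + Re (S x * cnj (S x))" for x
    unfolding cmod_power2 by (simp add: power2_eq_square algebra_simps)
  moreover have "((\<lambda>x. (cmod (u x))\<^sup>2 - 2 * Re (u x * cnj (S x)) + Re (S x * cnj (S x))) has_integral
      integral {a..a + P} (\<lambda>x. (cmod (u x))\<^sup>2) - 2 * Re (\<Sum>m\<in>F. cnj (c m) * b m)
        + Re (\<Sum>m\<in>F. c m * cnj (c m) * P)) {a..a + P}"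
    by (intro has_integral_add has_integral_diff has_integral_mult_right int_u re uS SS)
  ultimately have "integral {a..a + P} (\<lambda>x. (cmod (u x - S x))\<^sup>2)
      = integral {a..a + P} (\<lambda>x. (cmod (u x))\<^sup>2) - 2 * Re (\<Sum>m\<in>F. cnj (c m) * b m)
        + Re (\<Sum>m\<in>F. c m * cnj (c m) * P)"
    by (simp only: integral_unique)
  also have "\<dots> = integral {a..a + P} (\<lambda>x. (cmod (u x))\<^sup>2)
      + (\<Sum>m\<in>F. - 2 * Re (cnj (c m) * b m) + P * (cmod (c m))\<^sup>2)"
    by (simp add: sum.distrib sum_distrib_left complex_mult_cnj cmod_power2 sum_negf sum_subtractf mult_ac)
  also have "(\<Sum>m\<in>F. - 2 * Re (cnj (c m) * b m) + P * (cmod (c m))\<^sup>2)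
      = (\<Sum>m\<in>F. - (cmod (b m))\<^sup>2 / P + (cmod (b m - P * c m))\<^sup>2 / P)"
  proof (intro sum.cong refl)
    fix m
    show "- 2 * Re (cnj (c m) * b m) + P * (cmod (c m))\<^sup>2
      = - (cmod (b m))\<^sup>2 / P + (cmod (b m - P * c m))\<^sup>2 / P"
      using P unfolding cmod_power2 by (simp add: field_simps power2_eq_square)
  qed
  also have "\<dots> = - (\<Sum>m\<in>F. (cmod (b m))\<^sup>2) / P + (\<Sum>m\<in>F. (cmod (b m - P * c m))\<^sup>2) / P"
    by (simp add: sum.distrib sum_negf sum_divide_distrib diff_divide_distrib sum_subtractf)
  finally show ?thesis by (simp add: S_def e_def)
qed

text \<open>
  Bessel's inequality bounds the sum from above. From below, a uniformly close trigonometric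
  polynomial shows that finitely many coefficients already carry almost the whole energy.
\<close>

lemma parseval:
  fixes u :: "real \<Rightarrow> complex"
  assumes P: "P > 0" and cont: "continuous_on {a..a + P} u" and per: "u (a + P) = u a"
  shows "((\<lambda>m::int. (cmod (integral {a..a + P} (\<lambda>x. u x * cis (- 2 * pi * of_int m * x / P))))\<^sup>2)
    has_sum (P * integral {a..a + P} (\<lambda>x. (cmod (u x))\<^sup>2))) UNIV"
proof -
  define b where "b m = integral {a..a + P} (\<lambda>x. u x * cis (- 2 * pi * of_int m * x / P))" for m
  define E where "E = integral {a..a + P} (\<lambda>x. (cmod (u x))\<^sup>2)"
  note identity = integral_cmod_diff_trigonometric[OF P cont, folded b_def E_def]
  have cont_diff: "continuous_on {a..a + P} (\<lambda>x. (cmod (u x - (\<Sum>m\<in>F. c m * cis (2 * pi * of_int m * x / P))))\<^sup>2)" for F c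
    by (intro continuous_intros cont) (use P in auto)
  have bessel: "(\<Sum>m\<in>F. (cmod (b m))\<^sup>2) \<le> P * E" if F: "finite F" for F
  proof -
    \<comment> \<open>With these coefficients the last sum of the identity vanishes.\<close>
    define c where "c m = b m / P" for m
    have "0 \<le> integral {a..a + P} (\<lambda>x. (cmod (u x - (\<Sum>m\<in>F. c m * cis (2 * pi * of_int m * x / P))))\<^sup>2)"
      by (rule integral_nonneg[OF integrable_continuous_interval[OF cont_diff]]) auto
    moreover have "b m - P * c m = 0" for m
      using P by (simp add: c_def)
    ultimately have "0 \<le> E - (\<Sum>m\<in>F. (cmod (b m))\<^sup>2) / P"
      unfolding identity[OF F] by simp
    then show ?thesis using P by (simp add: field_simps)
  qed
  have summ: "(\<lambda>m. (cmod (b m))\<^sup>2) summable_on UNIV"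
    by (rule nonneg_bdd_above_summable_on) (auto intro!: bdd_aboveI2[of _ _ "P * E"] bessel)
  have "infsum (\<lambda>m. (cmod (b m))\<^sup>2) UNIV \<le> P * E"
    by (rule infsum_le_finite_sums[OF summ]) (auto intro: bessel)
  moreover have "P * E \<le> infsum (\<lambda>m. (cmod (b m))\<^sup>2) UNIV"
  proof (rule field_le_epsilon)
    fix d :: real assume d: "d > 0"
    \<comment> \<open>A uniform error \<open>e\<close> costs \<open>e\<^sup>2 * P\<close> in the energy, hence at most \<open>d\<close> after multiplying by \<open>P\<close>.\<close>
    define e where "e = sqrt d / P"
    have e: "e > 0" "e\<^sup>2 * P * P = d" using d P by (simp_all add: e_def power2_eq_square field_simps)
    obtain F c where F: "finite F"
      and Fc: "\<And>x. x \<in> {a..a + P} \<Longrightarrow> cmod (u x - (\<Sum>m\<in>F. c m * cis (2 * pi * of_int m * x / P))) < e"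
      using trigonometric_approximation[OF P cont per e(1)] by blast
    have "integral {a..a + P} (\<lambda>x. (cmod (u x - (\<Sum>m\<in>F. c m * cis (2 * pi * of_int m * x / P))))\<^sup>2)
        \<le> integral {a..a + P} (\<lambda>x. e\<^sup>2)"
      by (intro integral_le integrable_continuous_interval cont_diff continuous_on_const power_mono)
        (use Fc in \<open>auto intro: less_imp_le\<close>)
    then have "E - (\<Sum>m\<in>F. (cmod (b m))\<^sup>2) / P + (\<Sum>m\<in>F. (cmod (b m - P * c m))\<^sup>2) / P \<le> e\<^sup>2 * P"
      using P unfolding identity[OF F] by (simp add: mult.commute)
    then have "E - (\<Sum>m\<in>F. (cmod (b m))\<^sup>2) / P \<le> e\<^sup>2 * P"
      using P divide_nonneg_pos[OF sum_nonneg[of F "\<lambda>m. (cmod (b m - P * c m))\<^sup>2"] P] by simp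
    then have "E \<le> (\<Sum>m\<in>F. (cmod (b m))\<^sup>2) / P + e\<^sup>2 * P" by simp
    then have "P * E \<le> P * ((\<Sum>m\<in>F. (cmod (b m))\<^sup>2) / P + e\<^sup>2 * P)"
      using P by simp
    then have "P * E \<le> (\<Sum>m\<in>F. (cmod (b m))\<^sup>2) + d"
      using P e(2) by (simp add: distrib_left mult_ac)
    also have "(\<Sum>m\<in>F. (cmod (b m))\<^sup>2) \<le> infsum (\<lambda>m. (cmod (b m))\<^sup>2) UNIV"
      by (rule finite_sum_le_infsum[OF summ F]) auto
    finally show "P * E \<le> infsum (\<lambda>m. (cmod (b m))\<^sup>2) UNIV + d" by simp
  qed
  ultimately show ?thesis
    using summ by (simp add: has_sum_iff b_def E_def)
qed

section \<open>Periodization\<close>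

lemma
  fixes f :: "'i \<Rightarrow> real \<Rightarrow> 'c::banach"
  assumes cont: "\<And>l. continuous_on {a..b} (f l)"
    and bound: "\<And>l x. l \<in> A \<Longrightarrow> x \<in> {a..b} \<Longrightarrow> norm (f l x) \<le> M l"
    and summ: "M summable_on A"
  shows continuous_on_infsum: "continuous_on {a..b} (\<lambda>x. \<Sum>\<^sub>\<infinity>l\<in>A. f l x)"
    and has_sum_integral: "((\<lambda>l. integral {a..b} (f l)) has_sum integral {a..b} (\<lambda>x. \<Sum>\<^sub>\<infinity>l\<in>A. f l x)) A"
proof -
  have lim: "uniform_limit {a..b} (\<lambda>X x. \<Sum>l\<in>X. f l x) (\<lambda>x. \<Sum>\<^sub>\<infinity>l\<in>A. f l x) (finite_subsets_at_top A)"
    by (rule Weierstrass_m_test_general[OF bound summ])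
  have cont_sum: "continuous_on {a..b} (\<lambda>x. \<Sum>l\<in>X. f l x)" for X
    by (intro continuous_on_sum cont)
  show "continuous_on {a..b} (\<lambda>x. \<Sum>\<^sub>\<infinity>l\<in>A. f l x)"
    by (rule uniform_limit_theorem[OF _ lim]) (auto intro: cont_sum)
  obtain I J where I: "\<And>X. ((\<lambda>x. \<Sum>l\<in>X. f l x) has_integral I X) {a..b}"
    and J: "((\<lambda>x. \<Sum>\<^sub>\<infinity>l\<in>A. f l x) has_integral J) {a..b}" "(I \<longlongrightarrow> J) (finite_subsets_at_top A)"
    using uniform_limit_integral[OF lim cont_sum] by (metis finite_subsets_at_top_neq_bot)
  have "I X = (\<Sum>l\<in>X. integral {a..b} (f l))" if "finite X" for X
    using I[of X] that integral_sum[OF that, of f "{a..b}"] integrable_continuous_interval[OF cont]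
    by (simp add: has_integral_iff)
  then have "((\<lambda>X. \<Sum>l\<in>X. integral {a..b} (f l)) \<longlongrightarrow> J) (finite_subsets_at_top A)"
    using J(2) by (rule_tac Lim_transform_eventually)
      (auto intro!: eventually_finite_subsets_at_top_weakI)
  then show "((\<lambda>l. integral {a..b} (f l)) has_sum integral {a..b} (\<lambda>x. \<Sum>\<^sub>\<infinity>l\<in>A. f l x)) A"
    using J(1) by (simp add: has_sum_def integral_unique)
qed

lemma periodization_is_periodic:
  fixes v :: "real \<Rightarrow> 'c::banach"
  shows "(\<Sum>\<^sub>\<infinity>j. v (x + P + of_int j * P)) = (\<Sum>\<^sub>\<infinity>j. v (x + of_int j * P))"
proof -
  have "(\<Sum>\<^sub>\<infinity>j. v (x + of_int (j + 1) * P)) = (\<Sum>\<^sub>\<infinity>j. v (x + of_int j * P))"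
    by (rule infsum_reindex_bij_witness[of _ "\<lambda>j. j - 1" "\<lambda>j. j + 1"]) auto
  then show ?thesis by (simp add: algebra_simps)
qed

text \<open>
  The line is the disjoint union of the translates of one half-open period, and the integral over
  each translate is an integral over the base period.
\<close>

lemma integral_periodization:
  fixes v :: "real \<Rightarrow> complex"
  assumes P: "P > 0" and cont: "continuous_on UNIV v" and int: "integrable lborel v"
    and bound: "\<And>j::int. \<And>x. x \<in> {a..a + P} \<Longrightarrow> cmod (v (x + of_int j * P)) \<le> M j"
    and summ: "M summable_on UNIV"
  shows "(LINT x|lborel. v x) = integral {a..a + P} (\<lambda>x. \<Sum>\<^sub>\<infinity>j. v (x + of_int j * P))"
proof -
  define cell where "cell n = {a + of_int (int_decode n) * P..<a + (of_int (int_decode n) + 1) * P}" for n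
  \<comment> \<open>Half-open cells partition the line; the missing endpoint does not change the integrals.\<close>
  have cell_iff: "x \<in> cell n \<longleftrightarrow> \<lfloor>(x - a) / P\<rfloor> = int_decode n" for x n
    using P by (auto simp: cell_def floor_eq_iff field_simps)
  have Union: "(\<Union>n. cell n) = UNIV"
    by (auto simp: cell_iff) (metis int_encode_inverse)
  have disj: "cell m \<inter> cell n = {}" if "m \<noteq> n" for m n
    using that by (auto simp: cell_iff int_decode_eq)
  have set_int: "set_integrable lborel A v" if "A \<in> sets borel" for A
    using integrable_mult_indicator[of A lborel v] int that by (simp add: set_integrable_def)
  have cont_shift: "continuous_on A (\<lambda>x. v (x + t))" for A t
    by (rule continuous_on_compose2[OF cont]) (auto intro!: continuous_intros)
  have cell_integral: "(LINT x:cell n|lborel. v x)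
      = integral {a..a + P} (\<lambda>x. v (x + of_int (int_decode n) * P))" for n
  proof -
    define c where "c = of_int (int_decode n) * P"
    have "(LINT x:cell n|lborel. v x) = integral (cell n) v"
      by (rule set_borel_integral_eq_integral(2)[OF set_int]) (simp add: cell_def)
    also have "\<dots> = integral {a + c..a + c + P} v"
      by (rule integral_spike_set; rule negligible_subset[of "{a + c + P}"])
        (auto simp: cell_def c_def algebra_simps)
    also have "\<dots> = integral {a + c - c..a + c + P - c} (\<lambda>x. v (x + c))"
      by (simp only: integral_shift_real_ivl)
    finally show ?thesis by (simp add: c_def)
  qed
  have "((\<lambda>j. integral {a..a + P} (\<lambda>x. v (x + of_int j * P))) has_sum
      integral {a..a + P} (\<lambda>x. \<Sum>\<^sub>\<infinity>j. v (x + of_int j * P))) UNIV"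
    by (rule has_sum_integral[OF cont_shift bound summ])
  then have "((\<lambda>n. integral {a..a + P} (\<lambda>x. v (x + of_int (int_decode n) * P))) has_sum
      integral {a..a + P} (\<lambda>x. \<Sum>\<^sub>\<infinity>j. v (x + of_int j * P))) UNIV"
    using has_sum_reindex_bij_betw[OF bij_int_decode,
        of "\<lambda>j. integral {a..a + P} (\<lambda>x. v (x + of_int j * P))"] by simp
  then have "(\<Sum>n. LINT x:cell n|lborel. v x)
      = integral {a..a + P} (\<lambda>x. \<Sum>\<^sub>\<infinity>j. v (x + of_int j * P))"
    unfolding cell_integral by (rule sums_unique[OF has_sum_imp_sums, symmetric])
  moreover have "(LINT x:(\<Union>n. cell n)|lborel. v x) = (\<Sum>n. LINT x:cell n|lborel. v x)"
    by (rule lebesgue_integral_countable_add) (use disj set_int in \<open>auto simp: cell_def Union\<close>)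
  ultimately show ?thesis
    by (simp add: Union set_lebesgue_integral_def)
qed

lemma cis_mult_integrable:
  assumes "integrable lborel (G :: real \<Rightarrow> complex)"
  shows "integrable lborel (\<lambda>\<xi>. G \<xi> * cis (b * \<xi>))"
proof (rule Bochner_Integration.integrable_bound[OF assms])
  have "(\<lambda>\<xi>. cis (b * \<xi>)) \<in> borel_measurable borel"
    by (intro borel_measurable_continuous_onI continuous_intros)
  then show "(\<lambda>\<xi>. G \<xi> * cis (b * \<xi>)) \<in> borel_measurable lborel"
    using assms by measurable
qed (simp add: norm_mult)

text \<open>
  The exponentials have period \<open>P\<close>, so sampling the Fourier transform of \<open>v\<close> at the multiples of
  \<open>1 / P\<close> produces the Fourier coefficients of the periodization of \<open>v\<close>. This is used twice, with
  the roles of time and frequency exchanged: for the modulations and for the translations.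
\<close>

lemma parseval_periodization:
  fixes v :: "real \<Rightarrow> complex"
  assumes P: "P > 0" and cont: "continuous_on UNIV v" and int: "integrable lborel v"
    and bound: "\<And>j::int. \<And>x. x \<in> {a..a + P} \<Longrightarrow> cmod (v (x + of_int j * P)) \<le> M j"
    and summ: "M summable_on UNIV"
  shows "((\<lambda>m::int. (cmod (LINT x|lborel. v x * cis (- 2 * pi * of_int m * x / P)))\<^sup>2) has_sum
    (P * integral {a..a + P} (\<lambda>x. (cmod (\<Sum>\<^sub>\<infinity>j. v (x + of_int j * P)))\<^sup>2))) UNIV"
proof -
  have cont_shift: "continuous_on A (\<lambda>x. v (x + t))" for A t
    by (rule continuous_on_compose2[OF cont]) (auto intro!: continuous_intros)
  have coeff: "(LINT x|lborel. v x * cis (- 2 * pi * of_int m * x / P))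
      = integral {a..a + P} (\<lambda>x. (\<Sum>\<^sub>\<infinity>j. v (x + of_int j * P)) * cis (- 2 * pi * of_int m * x / P))" for m
  proof -
    have "cis (- 2 * pi * of_int m * (x + of_int j * P) / P) = cis (- 2 * pi * of_int m * x / P)" for j x
    proof -
      have "- 2 * pi * of_int m * (x + of_int j * P) / P
          = - 2 * pi * of_int m * x / P + 2 * pi * of_int (- m * j)"
        using P by (simp add: field_simps)
      then show ?thesis by (simp only: cis_mult[symmetric] cis_multiple_2pi[OF Ints_of_int] mult_1_right)
    qed
    moreover have "(LINT x|lborel. v x * cis (- 2 * pi * of_int m * x / P))
        = integral {a..a + P} (\<lambda>x. \<Sum>\<^sub>\<infinity>j. v (x + of_int j * P) * cis (- 2 * pi * of_int m * (x + of_int j * P) / P))"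
    proof (rule integral_periodization[OF P _ _ _ summ])
      show "continuous_on UNIV (\<lambda>x. v x * cis (- 2 * pi * of_int m * x / P))"
        by (intro continuous_intros cont) (use P in auto)
      show "integrable lborel (\<lambda>x. v x * cis (- 2 * pi * of_int m * x / P))"
        using cis_mult_integrable[OF int, of "- 2 * pi * of_int m / P"] by simp
    qed (use bound in \<open>simp add: norm_mult\<close>)
    ultimately show ?thesis by (simp add: infsum_cmult_left')
  qed
  show ?thesis
    unfolding coeff
    by (rule parseval[OF P]) (auto simp: periodization_is_periodic
        intro!: continuous_on_infsum[OF cont_shift bound summ])
qed

section \<open>Samples of a window with dominant spectrum\<close>

text \<open>
  The weighted sum of \<open>(y - t)\<^sup>2\<close> is nonnegative. Choosing \<open>t\<close> afterwards replaces both the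
  Cauchy-Schwarz and the Minkowski inequality for the infinite sums below.
\<close>

lemma weighted_am_gm:
  fixes p y :: "'i \<Rightarrow> real"
  assumes p: "\<And>l. l \<in> A \<Longrightarrow> p l \<ge> 0" "p summable_on A"
    and y: "\<And>l. l \<in> A \<Longrightarrow> 0 \<le> y l" "\<And>l. l \<in> A \<Longrightarrow> y l \<le> K"
  shows "(\<lambda>l. p l * y l) summable_on A" "(\<lambda>l. p l * (y l)\<^sup>2) summable_on A"
    and "2 * t * (\<Sum>\<^sub>\<infinity>l\<in>A. p l * y l) \<le> (\<Sum>\<^sub>\<infinity>l\<in>A. p l * (y l)\<^sup>2) + t\<^sup>2 * (\<Sum>\<^sub>\<infinity>l\<in>A. p l)"
proof -
  have Kp: "(\<lambda>l. p l * K) summable_on A" "(\<lambda>l. p l * K\<^sup>2) summable_on A"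
    using p(2) by (auto intro: summable_on_cmult_left)
  show 1: "(\<lambda>l. p l * y l) summable_on A"
    by (rule summable_on_comparison_test[OF Kp(1)]) (use p y in \<open>auto intro: mult_left_mono\<close>)
  show 2: "(\<lambda>l. p l * (y l)\<^sup>2) summable_on A"
    by (rule summable_on_comparison_test[OF Kp(2)])
      (use p y in \<open>auto intro!: mult_left_mono power_mono\<close>)
  have "2 * t * (\<Sum>\<^sub>\<infinity>l\<in>A. p l * y l) = (\<Sum>\<^sub>\<infinity>l\<in>A. 2 * t * (p l * y l))"
    by (simp add: infsum_cmult_right')
  also have "\<dots> \<le> (\<Sum>\<^sub>\<infinity>l\<in>A. p l * (y l)\<^sup>2 + t\<^sup>2 * p l)"
  proof (rule infsum_mono)
    fix l assume l: "l \<in> A"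
    have "0 \<le> p l * (y l - t)\<^sup>2" using p(1)[OF l] by simp
    then show "2 * t * (p l * y l) \<le> p l * (y l)\<^sup>2 + t\<^sup>2 * p l"
      by (simp add: power2_eq_square algebra_simps)
  qed (use 1 2 p in \<open>auto intro!: summable_on_cmult_right summable_on_add\<close>)
  also have "\<dots> = (\<Sum>\<^sub>\<infinity>l\<in>A. p l * (y l)\<^sup>2) + t\<^sup>2 * (\<Sum>\<^sub>\<infinity>l\<in>A. p l)"
    using 2 p by (simp add: infsum_add infsum_cmult_right' summable_on_cmult_right)
  finally show "2 * t * (\<Sum>\<^sub>\<infinity>l\<in>A. p l * y l) \<le> (\<Sum>\<^sub>\<infinity>l\<in>A. p l * (y l)\<^sup>2) + t\<^sup>2 * (\<Sum>\<^sub>\<infinity>l\<in>A. p l)" .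
qed

lemma integral_cmod_trigonometric:
  assumes "P > 0" "finite F"
  shows "integral {a..a + P} (\<lambda>x. (cmod (\<Sum>m\<in>F. c m * cis (2 * pi * of_int m * x / P)))\<^sup>2)
    = P * (\<Sum>m\<in>F. (cmod (c m))\<^sup>2)"
proof -
  have "integral {a..a + P} (\<lambda>x. (cmod (0 - (\<Sum>m\<in>F. c m * cis (2 * pi * of_int m * x / P))))\<^sup>2)
    = (\<Sum>m\<in>F. (cmod (0 - P * c m))\<^sup>2) / P"
    using integral_cmod_diff_trigonometric[OF assms(1) _ assms(2), of a "\<lambda>_. 0" c] by simp
  also have "\<dots> = P * (\<Sum>m\<in>F. (cmod (c m))\<^sup>2)"
    using assms(1) by (simp add: norm_mult power_mult_distrib sum_distrib_left sum_divide_distrib)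
      (simp add: power2_eq_square)
  finally show ?thesis by simp
qed

text \<open>
  Here \<open>g\<close> is the inverse Fourier transform of \<open>G\<close>. The annulus of all \<open>\<xi>\<close> with
  \<open>\<beta> / 2 \<le> \<bar>\<xi>\<bar> \<le> \<beta>\<close> is a fundamental domain for the translations by multiples of \<open>\<beta>\<close>, up to
  null sets: its left half, shifted by \<open>\<beta>\<close>, is the missing interval from \<open>0\<close> to \<open>\<beta> / 2\<close>. It
  keeps away from the origin, where \<open>G\<close> may vanish. The oversampling condition puts it inside one
  period of length \<open>1 / \<alpha>\<close>. The assumption \<open>dominant\<close> says that on the annulus the unshifted
  spectrum dominates all its translates by nonzero multiples of \<open>1 / \<alpha>\<close> together.
\<close>

locale dominant_spectrum =
  fixes g :: "real \<Rightarrow> complex" and G :: "real \<Rightarrow> complex" and \<alpha> \<beta> d :: real and p q :: "int \<Rightarrow> real"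
  assumes \<alpha>: "\<alpha> > 0" and \<beta>: "\<beta> > 0" and oversampling: "2 * \<beta> \<le> 1 / \<alpha>"
    and G_cont: "continuous_on UNIV G" and G_int: "integrable lborel G"
    and g_eq: "g t = (LINT \<xi>|lborel. G \<xi> * cis (2 * pi * \<xi> * t))"
    and p_bound: "\<bar>\<xi>\<bar> \<le> 1 / (2 * \<alpha>) \<Longrightarrow> cmod (G (\<xi> + of_int l / \<alpha>)) \<le> p l"
    and p_summable: "p summable_on UNIV"
    and d_bound: "\<beta> / 2 \<le> \<bar>\<xi>\<bar> \<Longrightarrow> \<bar>\<xi>\<bar> \<le> \<beta> \<Longrightarrow> d \<le> cmod (G \<xi>)"
    and q_bound: "\<bar>\<xi>\<bar> \<le> \<beta> \<Longrightarrow> l \<noteq> 0 \<Longrightarrow> cmod (G (\<xi> + of_int l / \<alpha>)) \<le> q l"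
    and q_summable: "q summable_on (-{0})"
    and dominant: "(\<Sum>\<^sub>\<infinity>l\<in>-{0}. q l) < d"
begin

abbreviation L :: real where "L \<equiv> 1 / \<alpha>"

definition Q :: real where "Q = (\<Sum>\<^sub>\<infinity>l\<in>-{0}. q l)"

definition S :: real where "S = (\<Sum>\<^sub>\<infinity>l. p l)"

text \<open>
  A period of length \<open>1 / \<alpha>\<close> is covered by this many periods of length \<open>\<beta>\<close>.
\<close>

definition N :: nat where "N = nat \<lceil>L / \<beta>\<rceil>"

lemma p_nonneg: "p l \<ge> 0"
  using order_trans[OF norm_ge_zero p_bound[of 0 l]] \<alpha> by simp

lemma q_nonneg: "l \<noteq> 0 \<Longrightarrow> q l \<ge> 0"
  using order_trans[OF norm_ge_zero q_bound[of 0 l]] \<beta> by simp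

lemma S_nonneg: "S \<ge> 0"
  unfolding S_def by (rule infsum_nonneg) (rule p_nonneg)

lemma N_ge: "L \<le> real N * \<beta>"
  using real_nat_ceiling_ge[of "L / \<beta>"] unfolding N_def pos_divide_le_eq[OF \<beta>] .

text \<open>
  Fix finitely many samples \<open>c j\<close> at the points \<open>x + j / \<beta>\<close>. Their trigonometric sum \<open>C\<close> has
  modulus of period \<open>\<beta>\<close>, while the samples at the points \<open>\<alpha> * k\<close> of the resulting combination
  of translates of \<open>g\<close> are the Fourier coefficients of \<open>\<Phi>\<close>, the periodization of \<open>G * C\<close> with
  period \<open>1 / \<alpha>\<close>. The interplay of these two periods is the whole problem.
\<close>

context
  fixes J :: "int set" and c :: "int \<Rightarrow> complex" and x :: real
  assumes J: "finite J"
begin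

definition C :: "real \<Rightarrow> complex" where
  "C \<xi> = (\<Sum>j\<in>J. c j * cis (2 * pi * \<xi> * (x + of_int j / \<beta>)))"

definition \<Phi> :: "real \<Rightarrow> complex" where
  "\<Phi> \<xi> = (\<Sum>\<^sub>\<infinity>l. G (\<xi> + of_int l * L) * C (\<xi> + of_int l * L))"

text \<open>
  The energy of \<open>C\<close> over one period.
\<close>

definition E :: real where "E = \<beta> * (\<Sum>j\<in>J. (cmod (c j))\<^sup>2)"

definition K :: real where "K = (\<Sum>j\<in>J. cmod (c j))"

lemma C_cont [continuous_intros]: "continuous_on A C"
  unfolding C_def by (intro continuous_intros) (use \<beta> in auto)

lemma C_shift_cont [continuous_intros]: "continuous_on A (\<lambda>\<xi>. C (\<xi> + t))"
  by (rule continuous_on_compose2[OF C_cont[of UNIV]]) (auto intro!: continuous_intros)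

lemma C_le: "cmod (C \<xi>) \<le> K"
  unfolding C_def K_def by (rule order_trans[OF norm_sum]) (simp add: norm_mult)

lemma cmod_C: "cmod (C \<xi>) = cmod (\<Sum>j\<in>J. c j * cis (2 * pi * of_int j * \<xi> / \<beta>))"
proof -
  have "C \<xi> = cis (2 * pi * \<xi> * x) * (\<Sum>j\<in>J. c j * cis (2 * pi * of_int j * \<xi> / \<beta>))"
    unfolding C_def sum_distrib_left
    by (intro sum.cong refl)
      (simp add: cis_mult mult.left_commute[of "cis _"] distrib_left mult_ac)
  then show ?thesis by (simp add: norm_mult)
qed

lemma cmod_C_periodic: "cmod (C (\<xi> + \<beta>)) = cmod (C \<xi>)"
proof -
  have "cis (2 * pi * of_int j * (\<xi> + \<beta>) / \<beta>) = cis (2 * pi * of_int j * \<xi> / \<beta>)" for j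
  proof -
    have "2 * pi * of_int j * (\<xi> + \<beta>) / \<beta> = 2 * pi * of_int j * \<xi> / \<beta> + 2 * pi * of_int j"
      using \<beta> by (simp add: field_simps)
    then show ?thesis by (simp flip: cis_mult)
  qed
  then show ?thesis by (simp add: cmod_C)
qed

lemma integral_C_period: "integral {a..a + \<beta>} (\<lambda>\<xi>. (cmod (C (\<xi> + t)))\<^sup>2) = E"
proof -
  have "integral {a..a + \<beta>} (\<lambda>\<xi>. (cmod (C (\<xi> + t)))\<^sup>2)
      = integral {a + t - t..a + t + \<beta> - t} (\<lambda>\<xi>. (cmod (C (\<xi> + t)))\<^sup>2)"
    by simp
  also have "\<dots> = integral {a + t..a + t + \<beta>} (\<lambda>\<xi>. (cmod (C \<xi>))\<^sup>2)"
    by (rule integral_shift_real_ivl)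
  also have "\<dots> = E"
    unfolding cmod_C E_def by (rule integral_cmod_trigonometric[OF \<beta> J])
  finally show ?thesis .
qed

text \<open>
  Shifting the left half of the annulus by the period \<open>\<beta>\<close> completes the right half to a full
  period.
\<close>

lemma integral_C_annulus:
  "integral {-\<beta>..-\<beta>/2} (\<lambda>\<xi>. (cmod (C (\<xi> + t)))\<^sup>2) + integral {\<beta>/2..\<beta>} (\<lambda>\<xi>. (cmod (C (\<xi> + t)))\<^sup>2) = E"
proof -
  have "integral {-\<beta>..-\<beta>/2} (\<lambda>\<xi>. (cmod (C (\<xi> + t)))\<^sup>2)
      = integral {0 - \<beta>..\<beta>/2 - \<beta>} (\<lambda>\<xi>. (cmod (C (\<xi> + \<beta> + t)))\<^sup>2)"
    using cmod_C_periodic[of "\<xi> + t" for \<xi>] by (simp add: add_ac)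
  also have "\<dots> = integral {0..\<beta>/2} (\<lambda>\<xi>. (cmod (C (\<xi> + t)))\<^sup>2)"
    by (rule integral_shift_real_ivl)
  finally have "integral {-\<beta>..-\<beta>/2} (\<lambda>\<xi>. (cmod (C (\<xi> + t)))\<^sup>2) + integral {\<beta>/2..\<beta>} (\<lambda>\<xi>. (cmod (C (\<xi> + t)))\<^sup>2)
      = integral {0..\<beta>} (\<lambda>\<xi>. (cmod (C (\<xi> + t)))\<^sup>2)"
    using \<beta> by (simp add: Henstock_Kurzweil_Integration.integral_combine
        integrable_continuous_interval continuous_intros)
  then show ?thesis using integral_C_period[of 0 t] by simp
qed

lemma integral_C_long: "integral {-L/2..L/2} (\<lambda>\<xi>. (cmod (C (\<xi> + t)))\<^sup>2) \<le> N * E"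
proof -
  have int: "(\<lambda>\<xi>. (cmod (C (\<xi> + t)))\<^sup>2) integrable_on {a..b}" for a b
    by (intro integrable_continuous_interval continuous_intros)
  have multiple: "integral {a..a + real n * \<beta>} (\<lambda>\<xi>. (cmod (C (\<xi> + t)))\<^sup>2) = n * E" for a n
  proof (induction n)
    case (Suc n)
    have "integral {a..a + real (Suc n) * \<beta>} (\<lambda>\<xi>. (cmod (C (\<xi> + t)))\<^sup>2)
        = integral {a..a + real n * \<beta>} (\<lambda>\<xi>. (cmod (C (\<xi> + t)))\<^sup>2)
          + integral {a + real n * \<beta>..a + real n * \<beta> + \<beta>} (\<lambda>\<xi>. (cmod (C (\<xi> + t)))\<^sup>2)"
      using \<beta> by (subst Henstock_Kurzweil_Integration.integral_combine[OF _ _ int])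
        (auto simp: algebra_simps)
    then show ?case
      unfolding Suc integral_C_period by (simp add: distrib_right)
  qed simp
  have "integral {-L/2..L/2} (\<lambda>\<xi>. (cmod (C (\<xi> + t)))\<^sup>2)
      \<le> integral {-L/2..-L/2 + real N * \<beta>} (\<lambda>\<xi>. (cmod (C (\<xi> + t)))\<^sup>2)"
    by (rule integral_subset_le[OF _ int int]) (use N_ge in auto)
  also have "\<dots> = N * E" by (rule multiple)
  finally show ?thesis .
qed

lemma GC_cont: "continuous_on A (\<lambda>\<xi>. G (\<xi> + t) * C (\<xi> + t))"
  by (intro continuous_intros continuous_on_compose2[OF G_cont]) auto

lemma GC_bound: "\<xi> \<in> {-L/2..-L/2 + L} \<Longrightarrow> cmod (G (\<xi> + of_int l * L) * C (\<xi> + of_int l * L)) \<le> p l * K"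
  unfolding norm_mult
  by (intro mult_mono C_le p_nonneg) (use p_bound[of \<xi> l] in \<open>auto simp: abs_le_iff\<close>)

lemma pK_summable: "(\<lambda>l. p l * K) summable_on UNIV"
  by (intro summable_on_cmult_left p_summable)

lemma \<Phi>_cont: "continuous_on {-L/2..L/2} \<Phi>"
  using continuous_on_infsum[OF GC_cont GC_bound pK_summable] by (simp add: \<Phi>_def[abs_def])

lemma fourier_C: "(LINT \<xi>|lborel. G \<xi> * C \<xi> * cis (- 2 * pi * of_int k * \<xi> / L))
    = (\<Sum>j\<in>J. c j * g (x + of_int j / \<beta> - \<alpha> * of_int k))"
proof -
  have int: "integrable lborel (\<lambda>\<xi>. G \<xi> * cis (2 * pi * \<xi> * t))" for t
    using cis_mult_integrable[OF G_int, of "2 * pi * t"] by (simp add: mult_ac)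
  have "G \<xi> * C \<xi> * cis (- 2 * pi * of_int k * \<xi> / L)
      = (\<Sum>j\<in>J. c j * (G \<xi> * cis (2 * pi * \<xi> * (x + of_int j / \<beta> - \<alpha> * of_int k))))" for \<xi>
    unfolding C_def sum_distrib_left sum_distrib_right
  proof (intro sum.cong refl)
    fix j
    have "cis (2 * pi * \<xi> * (x + of_int j / \<beta> - \<alpha> * of_int k))
        = cis (2 * pi * \<xi> * (x + of_int j / \<beta>)) * cis (- 2 * pi * of_int k * \<xi> / L)"
      unfolding cis_mult using \<alpha> by (intro arg_cong[where f = cis]) (simp add: algebra_simps)
    then show "G \<xi> * (c j * cis (2 * pi * \<xi> * (x + of_int j / \<beta>))) * cis (- 2 * pi * of_int k * \<xi> / L)
        = c j * (G \<xi> * cis (2 * pi * \<xi> * (x + of_int j / \<beta> - \<alpha> * of_int k)))"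
      by (simp only: mult_ac)
  qed
  then show ?thesis
    using int by (simp add: g_eq)
qed

lemma fiber_has_sum:
  "((\<lambda>k. (cmod (\<Sum>j\<in>J. c j * g (x + of_int j / \<beta> - \<alpha> * of_int k)))\<^sup>2)
    has_sum (L * integral {-L/2..L/2} (\<lambda>\<xi>. (cmod (\<Phi> \<xi>))\<^sup>2))) UNIV"
proof -
  have int: "integrable lborel (\<lambda>\<xi>. G \<xi> * C \<xi>)"
  proof (rule Bochner_Integration.integrable_bound)
    show "integrable lborel (\<lambda>\<xi>. K * cmod (G \<xi>))"
      using G_int by simp
    have "C \<in> borel_measurable borel"
      by (rule borel_measurable_continuous_onI[OF C_cont])
    then show "(\<lambda>\<xi>. G \<xi> * C \<xi>) \<in> borel_measurable lborel"
      using G_int by measurable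
    show "AE \<xi> in lborel. norm (G \<xi> * C \<xi>) \<le> norm (K * cmod (G \<xi>))"
    proof (intro AE_I2)
      fix \<xi>
      have "cmod (C \<xi>) \<le> \<bar>K\<bar>" using C_le[of \<xi>] by linarith
      then show "norm (G \<xi> * C \<xi>) \<le> norm (K * cmod (G \<xi>))"
        by (simp add: norm_mult abs_mult mult.commute mult_left_mono)
    qed
  qed
  have cont: "continuous_on UNIV (\<lambda>\<xi>. G \<xi> * C \<xi>)"
    by (intro continuous_intros G_cont)
  have "L > 0" and half: "-L/2 + L = L/2" using \<alpha> by auto
  from parseval_periodization[where a = "-L/2", OF \<open>L > 0\<close> cont int GC_bound pK_summable] show ?thesis
    unfolding fourier_C half \<Phi>_def .
qed

text \<open>
  Pointwise, \<open>\<Phi>\<close> is bounded by the translates of \<open>C\<close> with the summable weights \<open>p\<close>, and each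
  translate has at most the energy of \<open>N\<close> periods.
\<close>

lemma fiber_upper: "integral {-L/2..L/2} (\<lambda>\<xi>. (cmod (\<Phi> \<xi>))\<^sup>2) \<le> (S + 1) * S * N * E"
proof -
  define W where "W \<xi> = (\<Sum>\<^sub>\<infinity>l. p l * (cmod (C (\<xi> + of_int l * L)))\<^sup>2)" for \<xi>
  have pointwise: "(cmod (\<Phi> \<xi>))\<^sup>2 \<le> (S + 1) * W \<xi>" if \<xi>: "\<xi> \<in> {-L/2..L/2}" for \<xi>
  proof -
    define T where "T = (\<Sum>\<^sub>\<infinity>l. p l * cmod (C (\<xi> + of_int l * L)))"
    note am_gm = weighted_am_gm[of UNIV p "\<lambda>l. cmod (C (\<xi> + of_int l * L))" K,
        OF p_nonneg p_summable norm_ge_zero C_le]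
    have le: "norm (G (\<xi> + of_int l * L) * C (\<xi> + of_int l * L)) \<le> p l * cmod (C (\<xi> + of_int l * L))" for l
      unfolding norm_mult using p_bound[of \<xi> l] \<xi> by (intro mult_right_mono) (auto simp: abs_le_iff)
    have "cmod (\<Phi> \<xi>) \<le> T"
      unfolding \<Phi>_def T_def by (rule norm_infsum_le[OF has_sum_infsum has_sum_infsum le])
        (use le am_gm(1) in \<open>auto intro: abs_summable_summable[OF summable_on_comparison_test]\<close>)
    then have "(cmod (\<Phi> \<xi>))\<^sup>2 \<le> T\<^sup>2"
      by (rule power_mono) simp
    also have "T\<^sup>2 \<le> (S + 1) * W \<xi>"
    proof -
      \<comment> \<open>Dividing by \<open>S + 1\<close> instead of \<open>S\<close> avoids a case distinction on \<open>S = 0\<close>.\<close>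
      define t where "t = T / (S + 1)"
      have T: "T = t * (S + 1)" using S_nonneg by (simp add: t_def)
      have "2 * t * T \<le> W \<xi> + t\<^sup>2 * S"
        using am_gm(3)[of t] by (simp add: T_def W_def S_def)
      then have "t\<^sup>2 * (S + 1) + t\<^sup>2 \<le> W \<xi>"
        unfolding T by (simp add: algebra_simps power2_eq_square)
      then have "t\<^sup>2 * (S + 1) \<le> W \<xi>" using zero_le_power2[of t] by linarith
      then have "(S + 1) * (t\<^sup>2 * (S + 1)) \<le> (S + 1) * W \<xi>"
        using S_nonneg by (intro mult_left_mono) auto
      then show ?thesis unfolding T by (simp add: power2_eq_square mult_ac)
    qed
    finally show ?thesis .
  qed
  have K0: "K \<ge> 0" using order_trans[OF norm_ge_zero C_le[of 0]] .
  have cont: "continuous_on A (\<lambda>\<xi>. p l * (cmod (C (\<xi> + of_int l * L)))\<^sup>2)" for A l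
    by (intro continuous_intros)
  have bound: "norm (p l * (cmod (C (\<xi> + of_int l * L)))\<^sup>2) \<le> p l * K\<^sup>2" for l \<xi>
    using p_nonneg[of l] by (auto intro!: mult_left_mono power_mono C_le)
  have summ: "(\<lambda>l. p l * K\<^sup>2) summable_on UNIV"
    by (intro summable_on_cmult_left p_summable)
  have W_cont: "continuous_on {-L/2..L/2} W"
    unfolding W_def by (rule continuous_on_infsum[OF cont bound summ])
  have "((\<lambda>l. integral {-L/2..L/2} (\<lambda>\<xi>. p l * (cmod (C (\<xi> + of_int l * L)))\<^sup>2)) has_sum integral {-L/2..L/2} W) UNIV"
    unfolding W_def by (rule has_sum_integral[OF cont bound summ])
  moreover have "((\<lambda>l. p l * (N * E)) has_sum (S * (N * E))) UNIV"
    unfolding S_def by (intro has_sum_cmult_left has_sum_infsum p_summable)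
  ultimately have "integral {-L/2..L/2} W \<le> S * (N * E)"
    by (rule has_sum_mono) (use p_nonneg integral_C_long in \<open>auto intro!: mult_left_mono\<close>)
  moreover have "integral {-L/2..L/2} (\<lambda>\<xi>. (cmod (\<Phi> \<xi>))\<^sup>2) \<le> integral {-L/2..L/2} (\<lambda>\<xi>. (S + 1) * W \<xi>)"
    by (intro integral_le integrable_continuous_interval continuous_intros \<Phi>_cont W_cont pointwise)
  ultimately have "integral {-L/2..L/2} (\<lambda>\<xi>. (cmod (\<Phi> \<xi>))\<^sup>2) \<le> (S + 1) * (S * (N * E))"
    using S_nonneg by (auto intro: order_trans mult_left_mono)
  then show ?thesis by (simp add: mult_ac)
qed

text \<open>
  On the annulus \<open>\<Phi>\<close> is \<open>G * C\<close> up to the translates with \<open>l \<noteq> 0\<close>. Estimating these by \<open>q\<close> and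
  integrating over the annulus, each translate of \<open>C\<close> contributes the same energy \<open>E\<close>, because
  every translate of the annulus is again a fundamental domain. So the error is at most the
  fraction \<open>Q / d\<close> of the main term.
\<close>

lemma fiber_lower: "(d - Q)\<^sup>2 * E \<le> integral {-L/2..L/2} (\<lambda>\<xi>. (cmod (\<Phi> \<xi>))\<^sup>2)"
proof -
  define r where "r = d - Q"
  have r: "r > 0" using dominant by (simp add: r_def Q_def)
  define W where "W \<xi> = (\<Sum>\<^sub>\<infinity>l\<in>-{0}. q l * (cmod (C (\<xi> + of_int l * L)))\<^sup>2)" for \<xi>
  have pointwise: "d * (cmod (C \<xi>))\<^sup>2 \<le> (cmod (\<Phi> \<xi>))\<^sup>2 / r + W \<xi>" if \<xi>: "\<beta>/2 \<le> \<bar>\<xi>\<bar>" "\<bar>\<xi>\<bar> \<le> \<beta>" for \<xi>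
  proof -
    define v where "v l = G (\<xi> + of_int l * L) * C (\<xi> + of_int l * L)" for l :: int
    define T where "T = (\<Sum>\<^sub>\<infinity>l\<in>-{0}. q l * cmod (C (\<xi> + of_int l * L)))"
    have q_nonneg': "q l \<ge> 0" if "l \<in> -{0}" for l using q_nonneg that by simp
    note am_gm = weighted_am_gm[of "-{0}" q "\<lambda>l. cmod (C (\<xi> + of_int l * L))" K,
        OF q_nonneg' q_summable norm_ge_zero C_le]
    have le: "norm (v l) \<le> q l * cmod (C (\<xi> + of_int l * L))" if "l \<in> -{0}" for l
      unfolding v_def norm_mult using q_bound[OF \<xi>(2), of l] that by (intro mult_right_mono) auto
    have v_summable: "v summable_on (-{0})"
      by (rule abs_summable_summable[OF summable_on_comparison_test[OF am_gm(1)]])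
        (use le in auto)
    have UNIV_eq: "insert 0 (-{0}) = (UNIV :: int set)" by auto
    have "\<Phi> \<xi> = (\<Sum>\<^sub>\<infinity>l\<in>insert 0 (-{0}). v l)"
      by (simp add: \<Phi>_def v_def UNIV_eq)
    also have "\<dots> = v 0 + (\<Sum>\<^sub>\<infinity>l\<in>-{0}. v l)"
      using v_summable by (subst infsum_insert) auto
    finally have "v 0 = \<Phi> \<xi> - (\<Sum>\<^sub>\<infinity>l\<in>-{0}. v l)" by simp
    then have "cmod (v 0) \<le> cmod (\<Phi> \<xi>) + cmod (\<Sum>\<^sub>\<infinity>l\<in>-{0}. v l)"
      by (simp add: norm_triangle_ineq4)
    also have "cmod (\<Sum>\<^sub>\<infinity>l\<in>-{0}. v l) \<le> T"
      unfolding T_def by (rule norm_infsum_le[OF has_sum_infsum has_sum_infsum le])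
        (use v_summable am_gm(1) in auto)
    finally have "cmod (v 0) \<le> cmod (\<Phi> \<xi>) + T" by simp
    moreover have "d * cmod (C \<xi>) \<le> cmod (v 0)"
      using d_bound[OF \<xi>] by (simp add: v_def norm_mult mult_right_mono)
    ultimately have "cmod (C \<xi>) * (d * cmod (C \<xi>)) \<le> cmod (C \<xi>) * (cmod (\<Phi> \<xi>) + T)"
      by (intro mult_left_mono) auto
    then have "2 * d * (cmod (C \<xi>))\<^sup>2 \<le> 2 * cmod (\<Phi> \<xi>) * cmod (C \<xi>) + 2 * cmod (C \<xi>) * T"
      by (simp add: power2_eq_square algebra_simps)
    also have "2 * cmod (C \<xi>) * T \<le> W \<xi> + (cmod (C \<xi>))\<^sup>2 * Q"
      using am_gm(3)[of "cmod (C \<xi>)"] by (simp add: T_def W_def Q_def)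
    \<comment> \<open>The weight \<open>r\<close> is chosen since \<open>r + Q = d\<close>: half of the main term absorbs both error terms.\<close>
    also have "2 * cmod (\<Phi> \<xi>) * cmod (C \<xi>) \<le> (cmod (\<Phi> \<xi>))\<^sup>2 / r + r * (cmod (C \<xi>))\<^sup>2"
    proof -
      have "0 \<le> (cmod (\<Phi> \<xi>) - r * cmod (C \<xi>))\<^sup>2 / r" using r by simp
      also have "\<dots> = (cmod (\<Phi> \<xi>))\<^sup>2 / r + r * (cmod (C \<xi>))\<^sup>2 - 2 * cmod (\<Phi> \<xi>) * cmod (C \<xi>)"
        using r by (simp add: field_simps power2_eq_square)
      finally show ?thesis by simp
    qed
    finally show ?thesis by (simp add: r_def algebra_simps)
  qed
  have cont: "continuous_on A (\<lambda>\<xi>. q l * (cmod (C (\<xi> + of_int l * L)))\<^sup>2)" for A l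
    by (intro continuous_intros)
  have bound: "norm (q l * (cmod (C (\<xi> + of_int l * L)))\<^sup>2) \<le> q l * K\<^sup>2" if "l \<in> -{0}" for l \<xi>
    using q_nonneg[of l] that by (auto intro!: mult_left_mono power_mono C_le)
  have summ: "(\<lambda>l. q l * K\<^sup>2) summable_on -{0}"
    by (intro summable_on_cmult_left q_summable)
  have W_cont: "continuous_on {a..b} W" for a b
    unfolding W_def by (rule continuous_on_infsum[OF cont bound summ])
  have W_sum: "((\<lambda>l. integral {a..b} (\<lambda>\<xi>. q l * (cmod (C (\<xi> + of_int l * L)))\<^sup>2)) has_sum integral {a..b} W) (-{0})" for a b
    unfolding W_def by (rule has_sum_integral[OF cont bound summ])
  have "((\<lambda>l. q l * E) has_sum (integral {-\<beta>..-\<beta>/2} W + integral {\<beta>/2..\<beta>} W)) (-{0})"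
    using has_sum_add[OF W_sum[of "-\<beta>" "-\<beta>/2"] W_sum[of "\<beta>/2" \<beta>]]
    by (simp only: integral_mult_right distrib_left[symmetric] integral_C_annulus)
  moreover have "((\<lambda>l. q l * E) has_sum (Q * E)) (-{0})"
    unfolding Q_def by (intro has_sum_cmult_left has_sum_infsum q_summable)
  ultimately have W_int: "integral {-\<beta>..-\<beta>/2} W + integral {\<beta>/2..\<beta>} W = Q * E"
    by (rule has_sum_unique)
  have \<beta>L: "\<beta> \<le> L / 2" using oversampling by simp
  have \<Phi>_cont': "continuous_on A \<Phi>" if "A \<subseteq> {-L/2..L/2}" for A
    using \<Phi>_cont that by (rule continuous_on_subset)
  have \<Phi>_int: "(\<lambda>\<xi>. (cmod (\<Phi> \<xi>))\<^sup>2) integrable_on {a..b}" if "-L/2 \<le> a" "b \<le> L/2" for a b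
    by (intro integrable_continuous_interval continuous_intros \<Phi>_cont') (use that in auto)
  have on_interval: "d * integral {a..b} (\<lambda>\<xi>. (cmod (C (\<xi> + 0)))\<^sup>2)
      \<le> integral {a..b} (\<lambda>\<xi>. (cmod (\<Phi> \<xi>))\<^sup>2) / r + integral {a..b} W"
    if ab: "\<And>\<xi>. \<xi> \<in> {a..b} \<Longrightarrow> \<beta>/2 \<le> \<bar>\<xi>\<bar> \<and> \<bar>\<xi>\<bar> \<le> \<beta>" and "{a..b} \<subseteq> {-L/2..L/2}" for a b
  proof -
    have "integral {a..b} (\<lambda>\<xi>. d * (cmod (C \<xi>))\<^sup>2) \<le> integral {a..b} (\<lambda>\<xi>. (cmod (\<Phi> \<xi>))\<^sup>2 / r + W \<xi>)"
      by (intro integral_le integrable_continuous_interval continuous_intros \<Phi>_cont' W_cont pointwise)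
        (use r that in auto)
    also have "\<dots> = integral {a..b} (\<lambda>\<xi>. (cmod (\<Phi> \<xi>))\<^sup>2 / r) + integral {a..b} W"
      by (intro integral_add integrable_continuous_interval continuous_intros \<Phi>_cont' W_cont)
        (use r that in auto)
    finally show ?thesis by simp
  qed
  define I1 where "I1 = integral {-\<beta>..-\<beta>/2} (\<lambda>\<xi>. (cmod (\<Phi> \<xi>))\<^sup>2)"
  define I2 where "I2 = integral {\<beta>/2..\<beta>} (\<lambda>\<xi>. (cmod (\<Phi> \<xi>))\<^sup>2)"
  have "d * E \<le> (I1 + I2) / r + Q * E"
    using on_interval[of "-\<beta>" "-\<beta>/2"] on_interval[of "\<beta>/2" \<beta>] \<beta>L \<beta> W_int
      integral_C_annulus[of 0, symmetric]
    by (auto simp: I1_def I2_def add_divide_distrib distrib_left)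
  then have "r * E \<le> (I1 + I2) / r" by (simp add: r_def algebra_simps)
  then have "r\<^sup>2 * E \<le> I1 + I2" using r by (simp add: field_simps power2_eq_square)
  also have "I1 \<le> integral {-L/2..0} (\<lambda>\<xi>. (cmod (\<Phi> \<xi>))\<^sup>2)"
    unfolding I1_def by (rule integral_subset_le) (use \<beta>L \<beta> \<alpha> in \<open>auto intro!: \<Phi>_int\<close>)
  also have "I2 \<le> integral {0..L/2} (\<lambda>\<xi>. (cmod (\<Phi> \<xi>))\<^sup>2)"
    unfolding I2_def by (rule integral_subset_le) (use \<beta>L \<beta> \<alpha> in \<open>auto intro!: \<Phi>_int\<close>)
  also have "integral {-L/2..0} (\<lambda>\<xi>. (cmod (\<Phi> \<xi>))\<^sup>2) + integral {0..L/2} (\<lambda>\<xi>. (cmod (\<Phi> \<xi>))\<^sup>2)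
      = integral {-L/2..L/2} (\<lambda>\<xi>. (cmod (\<Phi> \<xi>))\<^sup>2)"
    using \<alpha> by (intro Henstock_Kurzweil_Integration.integral_combine \<Phi>_int) auto
  finally show ?thesis by (simp add: r_def)
qed

end

text \<open>
  The constants depend neither on the samples nor on \<open>x\<close>, which allows integration over \<open>x\<close>.
\<close>

lemma fiber_bounds:
  obtains A B where "A > 0" "B > 0"
    "\<And>J (c :: int \<Rightarrow> complex) x. finite J \<Longrightarrow>
      (\<lambda>k::int. (cmod (\<Sum>j\<in>J. c j * g (x + of_int j / \<beta> - \<alpha> * of_int k)))\<^sup>2) summable_on UNIV \<and>
      A * (\<Sum>j\<in>J. (cmod (c j))\<^sup>2)
        \<le> (\<Sum>\<^sub>\<infinity>k. (cmod (\<Sum>j\<in>J. c j * g (x + of_int j / \<beta> - \<alpha> * of_int k)))\<^sup>2) \<and>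
      (\<Sum>\<^sub>\<infinity>k. (cmod (\<Sum>j\<in>J. c j * g (x + of_int j / \<beta> - \<alpha> * of_int k)))\<^sup>2)
        \<le> B * (\<Sum>j\<in>J. (cmod (c j))\<^sup>2)"
proof -
  define A where "A = L * (d - Q)\<^sup>2 * \<beta>"
  define B where "B = L * ((S + 1) * S * N) * \<beta> + 1"
  have "A > 0" using \<alpha> \<beta> dominant by (simp add: A_def Q_def)
  moreover have "B > 0" using \<alpha> \<beta> S_nonneg by (auto simp: B_def intro!: add_nonneg_pos)
  moreover have "(\<lambda>k::int. (cmod (\<Sum>j\<in>J. c j * g (x + of_int j / \<beta> - \<alpha> * of_int k)))\<^sup>2) summable_on UNIV \<and>
      A * (\<Sum>j\<in>J. (cmod (c j))\<^sup>2)
        \<le> (\<Sum>\<^sub>\<infinity>k. (cmod (\<Sum>j\<in>J. c j * g (x + of_int j / \<beta> - \<alpha> * of_int k)))\<^sup>2) \<and>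
      (\<Sum>\<^sub>\<infinity>k. (cmod (\<Sum>j\<in>J. c j * g (x + of_int j / \<beta> - \<alpha> * of_int k)))\<^sup>2)
        \<le> B * (\<Sum>j\<in>J. (cmod (c j))\<^sup>2)" if J: "finite J" for J and c :: "int \<Rightarrow> complex" and x
  proof -
    define \<Sigma> where "\<Sigma> = (\<Sum>j\<in>J. (cmod (c j))\<^sup>2)"
    define X where "X = L * integral {-L/2..L/2} (\<lambda>\<xi>. (cmod (\<Phi> J c x \<xi>))\<^sup>2)"
    have "\<Sigma> \<ge> 0" by (simp add: \<Sigma>_def sum_nonneg)
    moreover have "L * ((d - Q)\<^sup>2 * (\<beta> * \<Sigma>)) \<le> X"
      unfolding X_def using fiber_lower[OF J, of c x] \<alpha>
      by (intro mult_left_mono) (auto simp: E_def[OF J] \<Sigma>_def)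
    moreover have "X \<le> L * ((S + 1) * S * N * (\<beta> * \<Sigma>))"
      unfolding X_def using fiber_upper[OF J, of c x] \<alpha>
      by (intro mult_left_mono) (auto simp: E_def[OF J] \<Sigma>_def)
    ultimately have "A * \<Sigma> \<le> X" "X \<le> B * \<Sigma>"
      by (auto simp: A_def B_def algebra_simps)
    then show ?thesis
      using fiber_has_sum[OF J, of c x] by (simp add: has_sum_iff X_def \<Sigma>_def)
  qed
  ultimately show ?thesis using that by blast
qed

end

section \<open>Frame bounds on compactly supported functions\<close>

lemma has_sum_int_of_sums:
  fixes X :: "int \<Rightarrow> real"
  assumes "(\<lambda>n. X (int_decode n)) sums I" "\<And>k. X k \<ge> 0"
  shows "(X has_sum I) UNIV"
  using sums_nonneg_imp_has_sum[OF assms]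
    has_sum_reindex_bij_betw[OF bij_int_decode, of X] by auto

lemma has_sum_imp_sums_int_decode:
  fixes X :: "int \<Rightarrow> real"
  assumes "(X has_sum I) UNIV"
  shows "(\<lambda>n. X (int_decode n)) sums I"
  using assms has_sum_reindex_bij_betw[OF bij_int_decode, of X] by (auto intro: has_sum_imp_sums)

text \<open>
  The pointwise bounds \<open>B * D\<close> dominate the partial sums, so sum and integral may be exchanged.
\<close>

lemma integral_infsum_bounds:
  fixes u :: "int \<Rightarrow> real \<Rightarrow> real"
  assumes cont: "\<And>k. continuous_on {a..b} (u k)" and nonneg: "\<And>k x. u k x \<ge> 0"
    and D: "continuous_on {a..b} D"
    and summ: "\<And>x. x \<in> {a..b} \<Longrightarrow> (\<lambda>k. u k x) summable_on UNIV"
    and lower: "\<And>x. x \<in> {a..b} \<Longrightarrow> A * D x \<le> (\<Sum>\<^sub>\<infinity>k. u k x)"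
    and upper: "\<And>x. x \<in> {a..b} \<Longrightarrow> (\<Sum>\<^sub>\<infinity>k. u k x) \<le> B * D x"
  obtains I where "((\<lambda>k. integral {a..b} (u k)) has_sum I) UNIV"
    "A * integral {a..b} D \<le> I" "I \<le> B * integral {a..b} D"
proof -
  define s where "s n x = (\<Sum>i<n. u (int_decode i) x)" for n x
  define U where "U x = (\<Sum>\<^sub>\<infinity>k. u k x)" for x
  have s_cont: "continuous_on {a..b} (s n)" for n
    unfolding s_def[abs_def] by (intro continuous_on_sum cont)
  have lim: "(\<lambda>n. s n x) \<longlonglongrightarrow> U x" if "x \<in> {a..b}" for x
    using has_sum_imp_sums_int_decode[of "\<lambda>k. u k x" "U x"] summ[OF that]
    by (simp add: U_def sums_def s_def)
  have mono: "s n x \<le> U x" if "x \<in> {a..b}" for n x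
    by (rule incseq_le[OF incseq_SucI lim[OF that]]) (simp add: s_def nonneg)
  have BD: "(\<lambda>x. B * D x) integrable_on {a..b}" "(\<lambda>x. A * D x) integrable_on {a..b}"
    by (intro integrable_continuous_interval continuous_intros D)+
  have s_bound: "norm (s n x) \<le> B * D x" if "x \<in> {a..b}" for n x
    using mono[OF that, of n] upper[OF that] sum_nonneg[of "{..<n}" "\<lambda>i. u (int_decode i) x"] nonneg
    by (simp add: s_def U_def)
  have U: "U integrable_on {a..b}" "(\<lambda>n. integral {a..b} (s n)) \<longlonglongrightarrow> integral {a..b} U"
    by (rule dominated_convergence[OF integrable_continuous_interval[OF s_cont] BD(1) s_bound lim];
        assumption)+
  have "integral {a..b} (s n) = (\<Sum>i<n. integral {a..b} (u (int_decode i)))" for n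
    unfolding s_def[abs_def] by (intro integral_sum integrable_continuous_interval cont) auto
  then have "(\<lambda>n. integral {a..b} (u (int_decode n))) sums integral {a..b} U"
    using U(2) by (simp add: sums_def)
  then have "((\<lambda>k. integral {a..b} (u k)) has_sum integral {a..b} U) UNIV"
    by (rule has_sum_int_of_sums) (auto intro!: integral_nonneg integrable_continuous_interval cont nonneg)
  moreover have "A * integral {a..b} D \<le> integral {a..b} U"
    using integral_le[OF BD(2) U(1)] lower by (simp add: U_def)
  moreover have "integral {a..b} U \<le> B * integral {a..b} D"
    using integral_le[OF U(1) BD(1)] upper by (simp add: U_def)
  ultimately show ?thesis by (rule that)
qed

lemma L2_norm_power2: "(L2_norm f)\<^sup>2 = (LINT x|lborel. (cmod (f x))\<^sup>2)"
  by (simp add: L2_norm_def)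

lemma integrable_compact_support:
  fixes v :: "real \<Rightarrow> 'c::{banach, second_countable_topology}"
  assumes "continuous_on UNIV v" "\<And>x. R < \<bar>x\<bar> \<Longrightarrow> v x = 0"
  shows "integrable lborel v"
proof -
  have "integrable lborel (\<lambda>x. indicator {-R..R} x *\<^sub>R v x)"
    by (rule borel_integrable_compact) (auto intro: continuous_on_subset[OF assms(1)])
  also have "(\<lambda>x. indicator {-R..R} x *\<^sub>R v x) = v"
    using assms(2) by (auto simp: fun_eq_iff indicator_def)
  finally show ?thesis .
qed

context dominant_spectrum
begin

text \<open>
  For fixed \<open>k\<close>, Parseval's identity sums over the modulations and leaves the energy of the
  periodization with period \<open>1 / \<beta>\<close> of \<open>f\<close> times the translated window. For fixed \<open>x\<close>, the sum
  over \<open>k\<close> of the squared moduli of these periodizations is a fibre expression with the samples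
  \<open>f (x + j / \<beta>)\<close>; compact support makes it a finite one. Integrating the fibre bounds over \<open>x\<close>
  reassembles the norm of \<open>f\<close>.
\<close>

lemma gabor_bounds_compact_support:
  assumes g_cont: "continuous_on UNIV g"
  obtains A B where "A > 0" "B > 0"
    "\<And>f R. continuous_on UNIV f \<Longrightarrow> (\<And>x. R < \<bar>x\<bar> \<Longrightarrow> f x = 0) \<Longrightarrow>
      (\<lambda>i. (cmod (L2_inner f (gabor_system g \<alpha> \<beta> i)))\<^sup>2) summable_on UNIV \<and>
      A * (L2_norm f)\<^sup>2 \<le> (\<Sum>\<^sub>\<infinity>i. (cmod (L2_inner f (gabor_system g \<alpha> \<beta> i)))\<^sup>2) \<and>
      (\<Sum>\<^sub>\<infinity>i. (cmod (L2_inner f (gabor_system g \<alpha> \<beta> i)))\<^sup>2) \<le> B * (L2_norm f)\<^sup>2"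
proof -
  obtain A B where AB: "A > 0" "B > 0"
    and fiber: "\<And>J (c :: int \<Rightarrow> complex) x. finite J \<Longrightarrow>
      (\<lambda>k::int. (cmod (\<Sum>j\<in>J. c j * g (x + of_int j / \<beta> - \<alpha> * of_int k)))\<^sup>2) summable_on UNIV \<and>
      A * (\<Sum>j\<in>J. (cmod (c j))\<^sup>2)
        \<le> (\<Sum>\<^sub>\<infinity>k. (cmod (\<Sum>j\<in>J. c j * g (x + of_int j / \<beta> - \<alpha> * of_int k)))\<^sup>2) \<and>
      (\<Sum>\<^sub>\<infinity>k. (cmod (\<Sum>j\<in>J. c j * g (x + of_int j / \<beta> - \<alpha> * of_int k)))\<^sup>2)
        \<le> B * (\<Sum>j\<in>J. (cmod (c j))\<^sup>2)"
    using fiber_bounds by blast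
  define P where "P = 1 / \<beta>"
  have P: "P > 0" using \<beta> by (simp add: P_def)
  have bounds: "(\<lambda>i. (cmod (L2_inner f (gabor_system g \<alpha> \<beta> i)))\<^sup>2) summable_on UNIV \<and>
      P * A * (L2_norm f)\<^sup>2 \<le> (\<Sum>\<^sub>\<infinity>i. (cmod (L2_inner f (gabor_system g \<alpha> \<beta> i)))\<^sup>2) \<and>
      (\<Sum>\<^sub>\<infinity>i. (cmod (L2_inner f (gabor_system g \<alpha> \<beta> i)))\<^sup>2) \<le> P * B * (L2_norm f)\<^sup>2"
    if f_cont: "continuous_on UNIV f" and f_supp: "\<And>x. R < \<bar>x\<bar> \<Longrightarrow> f x = 0" for f R
  proof -
    \<comment> \<open>For \<open>x\<close> in the base period, only the shifts \<open>j\<close> between \<open>- n\<close> and \<open>n\<close> can meet the support.\<close>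
    define n where "n = \<lceil>\<bar>R\<bar> / P\<rceil> + 1"
    define J where "J = {-n..n}"
    have J: "finite J" by (simp add: J_def)
    have outside: "f (x + of_int j * P) = 0" if "x \<in> {0..P}" "j \<notin> J" for x j
    proof (rule f_supp)
      have "\<bar>R\<bar> / P + 1 \<le> of_int n" unfolding n_def by linarith
      then have n: "\<bar>R\<bar> + P \<le> of_int n * P" using P by (simp add: field_simps)
      from that(2) consider "n + 1 \<le> j" | "j \<le> - n - 1" by (fastforce simp: J_def)
      then show "R < \<bar>x + of_int j * P\<bar>"
      proof cases
        case 1
        then have "of_int (n + 1) * P \<le> of_int j * P"
          using P by (intro mult_right_mono) linarith+
        then have "of_int n * P + P \<le> of_int j * P" by (simp add: algebra_simps)
        moreover have "0 \<le> x" using that by simp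
        ultimately show ?thesis using n P by linarith
      next
        case 2
        then have "of_int j * P \<le> of_int (- n - 1) * P"
          using P by (intro mult_right_mono) linarith+
        then have "of_int j * P \<le> - (of_int n * P) - P" by (simp add: algebra_simps)
        moreover have "x \<le> P" using that by simp
        ultimately show ?thesis using n P by linarith
      qed
    qed
    have cont_shift: "continuous_on A (\<lambda>x. v (x + t))" if "continuous_on UNIV v" for A t and v :: "real \<Rightarrow> complex"
      by (rule continuous_on_compose2[OF that]) (auto intro!: continuous_intros)
    have dominated: "\<exists>M. M summable_on UNIV \<and> (\<forall>j x. x \<in> {0..0 + P} \<longrightarrow> cmod (v (x + of_int j * P)) \<le> M j)"
      if v: "continuous_on UNIV v" "\<And>x. f x = 0 \<Longrightarrow> v x = 0" for v :: "real \<Rightarrow> complex"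
    proof -
      have "bounded (v ` {-R..R})"
        by (intro compact_imp_bounded compact_continuous_image continuous_on_subset[OF v(1)]) auto
      then obtain K where K: "\<And>x. x \<in> {-R..R} \<Longrightarrow> cmod (v x) \<le> K"
        unfolding bounded_iff by blast
      have le: "cmod (v x) \<le> \<bar>K\<bar>" for x
        using K[of x] v(2)[OF f_supp, of x] by (cases "x \<in> {-R..R}") auto
      have "(\<lambda>j. if j \<in> J then \<bar>K\<bar> else 0) summable_on UNIV"
        by (rule finite_nonzero_values_imp_summable_on) (use J in \<open>auto intro: finite_subset\<close>)
      moreover have "cmod (v (x + of_int j * P)) \<le> (if j \<in> J then \<bar>K\<bar> else 0)" if "x \<in> {0..0 + P}" for j x
        using le v(2) outside[of x j] that by auto
      ultimately show ?thesis by blast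
    qed
    have infsum_J: "(\<Sum>\<^sub>\<infinity>j. v (x + of_int j * P)) = (\<Sum>j\<in>J. v (x + of_int j * P))"
      if "x \<in> {0..P}" "\<And>x. f x = 0 \<Longrightarrow> v x = 0" for v :: "real \<Rightarrow> complex" and x
    proof -
      have "(\<Sum>\<^sub>\<infinity>j. v (x + of_int j * P)) = (\<Sum>\<^sub>\<infinity>j\<in>J. v (x + of_int j * P))"
        by (rule infsum_cong_neutral) (use outside that in auto)
      then show ?thesis using J by simp
    qed

    define D where "D x = (\<Sum>j\<in>J. (cmod (f (x + of_int j * P)))\<^sup>2)" for x
    have D_cont: "continuous_on {0..P} D"
      unfolding D_def[abs_def] by (intro continuous_intros cont_shift f_cont)
    have norm_f: "(L2_norm f)\<^sup>2 = integral {0..P} D"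
    proof -
      define w where "w x = complex_of_real ((cmod (f x))\<^sup>2)" for x
      have w_cont: "continuous_on UNIV w"
        unfolding w_def[abs_def] by (intro continuous_intros f_cont)
      have w0: "w x = 0" if "f x = 0" for x using that by (simp add: w_def)
      have w_int: "integrable lborel w"
        by (rule integrable_compact_support[OF w_cont]) (use f_supp w0 in auto)
      obtain M where M: "M summable_on UNIV" "\<And>j x. x \<in> {0..0 + P} \<Longrightarrow> cmod (w (x + of_int j * P)) \<le> M j"
        using dominated[OF w_cont w0] by blast
      have "(LINT x|lborel. w x) = integral {0..0 + P} (\<lambda>x. \<Sum>\<^sub>\<infinity>j. w (x + of_int j * P))"
        by (rule integral_periodization[OF P w_cont w_int M(2,1)])
      also have "\<dots> = integral {0..P} (\<lambda>x. complex_of_real (D x))"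
        using infsum_J[of _ w, OF _ w0] unfolding add_0
        by (intro integral_cong) (auto simp: D_def w_def)
      also have "\<dots> = complex_of_real (integral {0..P} D)"
        using integral_linear[OF integrable_continuous_interval[OF D_cont] bounded_linear_of_real]
        by (simp add: o_def)
      finally have "complex_of_real ((L2_norm f)\<^sup>2) = complex_of_real (integral {0..P} D)"
        by (simp only: w_def L2_norm_power2 integral_complex_of_real)
      then show ?thesis by (simp only: of_real_eq_iff)
    qed

    \<comment> \<open>Conjugation moves the conjugate from the window to the samples, as the fibre bounds require.\<close>
    define V where "V k x = (\<Sum>j\<in>J. cnj (f (x + of_int j * P)) * g (x + of_int j / \<beta> - \<alpha> * of_int k))" for k x
    have V_cont: "continuous_on {0..P} (V k)" for k
      unfolding V_def[abs_def] using \<beta>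
      by (intro continuous_intros cont_shift f_cont continuous_on_compose2[OF g_cont]) auto
    have along_modulations: "((\<lambda>m. (cmod (L2_inner f (gabor_system g \<alpha> \<beta> (m, k))))\<^sup>2) has_sum
        (P * integral {0..P} (\<lambda>x. (cmod (V k x))\<^sup>2))) UNIV" for k
    proof -
      define h where "h x = f x * cnj (g (x - \<alpha> * of_int k))" for x
      have h_cont: "continuous_on UNIV h"
        unfolding h_def[abs_def]
        by (intro continuous_intros f_cont continuous_on_compose2[OF g_cont]) auto
      have h0: "h x = 0" if "f x = 0" for x using that by (simp add: h_def)
      have h_int: "integrable lborel h"
        by (rule integrable_compact_support[OF h_cont]) (use f_supp h0 in auto)
      obtain M where M: "M summable_on UNIV" "\<And>j x. x \<in> {0..0 + P} \<Longrightarrow> cmod (h (x + of_int j * P)) \<le> M j"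
        using dominated[OF h_cont h0] by blast
      have "f x * cnj (gabor_system g \<alpha> \<beta> (m, k) x) = h x * cis (- 2 * pi * of_int m * x / P)" for m x
      proof -
        have "- (2 * pi * \<beta> * of_int m * x) = - 2 * pi * of_int m * x / P"
          by (simp add: P_def)
        then show ?thesis
          by (simp add: gabor_system_def h_def cis_cnj)
      qed
      then have coeff: "L2_inner f (gabor_system g \<alpha> \<beta> (m, k))
          = (LINT x|lborel. h x * cis (- 2 * pi * of_int m * x / P))" for m
        by (simp only: L2_inner_def)
      have fold: "integral {0..0 + P} (\<lambda>x. (cmod (\<Sum>\<^sub>\<infinity>j. h (x + of_int j * P)))\<^sup>2)
          = integral {0..P} (\<lambda>x. (cmod (V k x))\<^sup>2)"
      proof -
        have "cmod (\<Sum>\<^sub>\<infinity>j. h (x + of_int j * P)) = cmod (V k x)" if "x \<in> {0..P}" for x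
        proof -
          have "(\<Sum>\<^sub>\<infinity>j. h (x + of_int j * P)) = cnj (V k x)"
            using infsum_J[of x h, OF that h0] by (simp add: h_def V_def P_def)
          then show ?thesis by simp
        qed
        then show ?thesis unfolding add_0 by (intro integral_cong) simp
      qed
      show ?thesis
        using parseval_periodization[where a = 0, OF P h_cont h_int M(2,1)] unfolding coeff fold .
    qed

    have fiber_V: "(\<lambda>k. (cmod (V k x))\<^sup>2) summable_on UNIV"
        "A * D x \<le> (\<Sum>\<^sub>\<infinity>k. (cmod (V k x))\<^sup>2)" "(\<Sum>\<^sub>\<infinity>k. (cmod (V k x))\<^sup>2) \<le> B * D x" for x
      using fiber[OF J, of "\<lambda>j. cnj (f (x + of_int j * P))" x] by (simp_all add: V_def D_def)
    obtain I where I: "((\<lambda>k. integral {0..P} (\<lambda>x. (cmod (V k x))\<^sup>2)) has_sum I) UNIV"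
      "A * integral {0..P} D \<le> I" "I \<le> B * integral {0..P} D"
    proof (rule integral_infsum_bounds[of 0 P "\<lambda>k x. (cmod (V k x))\<^sup>2" D A B])
      show "continuous_on {0..P} (\<lambda>x. (cmod (V k x))\<^sup>2)" for k
        by (intro continuous_intros V_cont)
    qed (rule D_cont fiber_V zero_le_power2 | assumption)+
    have outer: "((\<lambda>k. P * integral {0..P} (\<lambda>x. (cmod (V k x))\<^sup>2)) has_sum (P * I)) UNIV"
      by (rule has_sum_cmult_right[OF I(1)])
    define \<phi> where "\<phi> = (\<lambda>(k, m). (cmod (L2_inner f (gabor_system g \<alpha> \<beta> (m, k))))\<^sup>2)"
    have inner: "((\<lambda>m. \<phi> (k, m)) has_sum (P * integral {0..P} (\<lambda>x. (cmod (V k x))\<^sup>2))) UNIV" for k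
      using along_modulations[of k] by (simp add: \<phi>_def)
    have "\<phi> summable_on Sigma UNIV (\<lambda>_. UNIV)"
      by (rule summable_on_SigmaI[OF inner has_sum_imp_summable[OF outer]]) (auto simp: \<phi>_def)
    then have "(\<phi> has_sum (P * I)) UNIV"
      using has_sum_SigmaI[OF inner outer] by simp
    then have "((\<lambda>i. \<phi> (prod.swap i)) has_sum (P * I)) UNIV"
      using has_sum_reindex_bij_betw[OF bij_swap, of \<phi>] by simp
    moreover have "\<phi> (prod.swap i) = (cmod (L2_inner f (gabor_system g \<alpha> \<beta> i)))\<^sup>2" for i
      by (cases i) (simp add: \<phi>_def)
    ultimately show ?thesis
      using I(2,3) P by (simp add: has_sum_iff norm_f)
  qed
  show ?thesis
  proof (rule that[of "P * A" "P * B"])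
    show "P * A > 0" "P * B > 0" using AB P by simp_all
  qed (rule bounds)
qed

end

section \<open>Extension to square-integrable functions by density\<close>

lemma L2_measurable: "f \<in> L2 \<Longrightarrow> f \<in> borel_measurable borel"
  and L2_integrable: "f \<in> L2 \<Longrightarrow> integrable lborel (\<lambda>x. (cmod (f x))\<^sup>2)"
  by (auto simp: L2_def)

lemma cmod_add_power2_le: "(cmod (a + b))\<^sup>2 \<le> 2 * (cmod a)\<^sup>2 + 2 * (cmod b)\<^sup>2"
proof -
  have "(cmod (a + b))\<^sup>2 \<le> (cmod a + cmod b)\<^sup>2"
    by (intro power_mono norm_triangle_ineq) simp
  also have "\<dots> \<le> 2 * (cmod a)\<^sup>2 + 2 * (cmod b)\<^sup>2"
    using zero_le_power2[of "cmod a - cmod b"] by (simp add: power2_eq_square algebra_simps)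
  finally show ?thesis .
qed

lemma L2_add:
  assumes "f \<in> L2" "h \<in> L2"
  shows "(\<lambda>x. f x + h x) \<in> L2"
    and L2_norm_add_le: "(L2_norm (\<lambda>x. f x + h x))\<^sup>2 \<le> 2 * (L2_norm f)\<^sup>2 + 2 * (L2_norm h)\<^sup>2"
proof -
  note [measurable] = assms[THEN L2_measurable]
  note int = assms[THEN L2_integrable]
  have bound: "integrable lborel (\<lambda>x. 2 * (cmod (f x))\<^sup>2 + 2 * (cmod (h x))\<^sup>2)"
    using int by simp
  have int_sum: "integrable lborel (\<lambda>x. (cmod (f x + h x))\<^sup>2)"
  proof (rule Bochner_Integration.integrable_bound[OF bound])
    show "AE x in lborel. norm ((cmod (f x + h x))\<^sup>2) \<le> norm (2 * (cmod (f x))\<^sup>2 + 2 * (cmod (h x))\<^sup>2)"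
      by (intro AE_I2) (simp add: cmod_add_power2_le)
  qed measurable
  then show "(\<lambda>x. f x + h x) \<in> L2"
    by (simp add: L2_def)
  have "(L2_norm (\<lambda>x. f x + h x))\<^sup>2 \<le> (LINT x|lborel. 2 * (cmod (f x))\<^sup>2 + 2 * (cmod (h x))\<^sup>2)"
    unfolding L2_norm_power2 by (intro integral_mono int_sum bound cmod_add_power2_le)
  also have "\<dots> = 2 * (L2_norm f)\<^sup>2 + 2 * (L2_norm h)\<^sup>2"
    using int by (simp add: L2_norm_power2)
  finally show "(L2_norm (\<lambda>x. f x + h x))\<^sup>2 \<le> 2 * (L2_norm f)\<^sup>2 + 2 * (L2_norm h)\<^sup>2" .
qed

lemma L2_norm_uminus: "L2_norm (\<lambda>x. - f x) = L2_norm f"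
  by (simp add: L2_norm_def)

lemma L2_uminus: "f \<in> L2 \<Longrightarrow> (\<lambda>x. - f x) \<in> L2"
  by (simp add: L2_def)

lemma L2_diff: "f \<in> L2 \<Longrightarrow> h \<in> L2 \<Longrightarrow> (\<lambda>x. f x - h x) \<in> L2"
  using L2_add[OF _ L2_uminus, of f h] by simp

lemma
  assumes "f \<in> L2" "h \<in> L2"
  shows L2_inner_integrable: "integrable lborel (\<lambda>x. f x * cnj (h x))"
    and L2_inner_bound: "t > 0 \<Longrightarrow> 2 * cmod (L2_inner f h) \<le> t * (L2_norm f)\<^sup>2 + (L2_norm h)\<^sup>2 / t"
proof -
  note [measurable] = assms[THEN L2_measurable]
  have [measurable]: "(\<lambda>x. cnj (h x)) \<in> borel_measurable borel"
    by (rule measurable_compose[of h borel borel cnj])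
      (auto intro: borel_measurable_continuous_onI continuous_intros)
  note int = assms[THEN L2_integrable]
  have young: "2 * cmod (f x * cnj (h x)) \<le> t * (cmod (f x))\<^sup>2 + (cmod (h x))\<^sup>2 / t" if "t > 0" for t x
  proof -
    have "0 \<le> (t * cmod (f x) - cmod (h x))\<^sup>2 / t" using that by simp
    also have "\<dots> = t * (cmod (f x))\<^sup>2 + (cmod (h x))\<^sup>2 / t - 2 * (cmod (f x) * cmod (h x))"
      using that by (simp add: field_simps power2_eq_square)
    finally show ?thesis by (simp add: norm_mult)
  qed
  show int_prod: "integrable lborel (\<lambda>x. f x * cnj (h x))"
  proof (rule Bochner_Integration.integrable_bound)
    show "integrable lborel (\<lambda>x. (cmod (f x))\<^sup>2 + (cmod (h x))\<^sup>2)" using int by simp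
    show "AE x in lborel. norm (f x * cnj (h x)) \<le> norm ((cmod (f x))\<^sup>2 + (cmod (h x))\<^sup>2)"
    proof (intro AE_I2)
      fix x
      have "2 * cmod (f x * cnj (h x)) \<le> (cmod (f x))\<^sup>2 + (cmod (h x))\<^sup>2" using young[of 1 x] by simp
      then show "norm (f x * cnj (h x)) \<le> norm ((cmod (f x))\<^sup>2 + (cmod (h x))\<^sup>2)"
        using norm_ge_zero[of "f x * cnj (h x)"] unfolding real_norm_def by linarith
    qed
  qed measurable
  assume t: "t > 0"
  have "cmod (L2_inner f h) \<le> (LINT x|lborel. cmod (f x * cnj (h x)))"
    unfolding L2_inner_def by (rule integral_norm_bound)
  then have "2 * cmod (L2_inner f h) \<le> (LINT x|lborel. 2 * cmod (f x * cnj (h x)))"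
    by simp
  also have "\<dots> \<le> (LINT x|lborel. t * (cmod (f x))\<^sup>2 + (cmod (h x))\<^sup>2 / t)"
    using int int_prod t by (intro integral_mono young) (auto intro: integrable_norm)
  also have "\<dots> = t * (L2_norm f)\<^sup>2 + (L2_norm h)\<^sup>2 / t"
    using int t by (simp add: L2_norm_power2)
  finally show "2 * cmod (L2_inner f h) \<le> t * (L2_norm f)\<^sup>2 + (L2_norm h)\<^sup>2 / t" .
qed

text \<open>
  A weak form of the Cauchy-Schwarz inequality. The summand \<open>1\<close> makes the weight in Young's
  inequality positive also when \<open>h\<close> vanishes almost everywhere.
\<close>

lemma L2_inner_power2_le:
  assumes "f \<in> L2" "h \<in> L2"
  shows "(cmod (L2_inner f h))\<^sup>2 \<le> (L2_norm f)\<^sup>2 * ((L2_norm h)\<^sup>2 + 1)"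
proof -
  define a where "a = cmod (L2_inner f h)"
  define N where "N = (L2_norm h)\<^sup>2 + 1"
  have N: "N > 0" by (simp add: N_def add_nonneg_pos)
  have "(cmod (L2_inner f h))\<^sup>2 \<le> (L2_norm f)\<^sup>2 * N"
  proof (cases "a = 0")
    case True
    then show ?thesis using N by (simp add: a_def)
  next
    case False
    then have a: "a > 0" by (simp add: a_def)
    have "2 * a \<le> N / a * (L2_norm f)\<^sup>2 + (L2_norm h)\<^sup>2 / (N / a)"
      unfolding a_def by (rule L2_inner_bound[OF assms]) (use a N in \<open>simp add: a_def\<close>)
    also have "(L2_norm h)\<^sup>2 / (N / a) = a * ((L2_norm h)\<^sup>2 / N)" by simp
    also have "\<dots> \<le> a * 1" using a N by (intro mult_left_mono) (auto simp: N_def)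
    finally have "a \<le> N / a * (L2_norm f)\<^sup>2" by simp
    then have "a * a \<le> N * (L2_norm f)\<^sup>2" using a by (simp add: field_simps)
    then show ?thesis by (simp add: a_def power2_eq_square mult_ac)
  qed
  then show ?thesis by (simp add: N_def)
qed

lemma L2_inner_add:
  assumes "f \<in> L2" "h \<in> L2" "e \<in> L2"
  shows "L2_inner (\<lambda>x. f x + h x) e = L2_inner f e + L2_inner h e"
  using assms by (simp add: L2_inner_def distrib_right L2_inner_integrable)

lemma le_of_le_add_multiple:
  fixes a b c :: real
  assumes "c \<ge> 0" "\<And>\<epsilon>. \<epsilon> > 0 \<Longrightarrow> a \<le> b + c * \<epsilon>"
  shows "a \<le> b"
proof (rule field_le_epsilon)
  fix \<delta> :: real assume \<delta>: "\<delta> > 0"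
  have "a \<le> b + c * (\<delta> / (c + 1))" using assms \<delta> by (intro assms(2)) simp
  also have "c * (\<delta> / (c + 1)) \<le> \<delta>" using assms(1) \<delta> by (simp add: field_simps)
  finally show "a \<le> b + \<delta>" by simp
qed

text \<open>
  The elementary inequality \<open>\<bar>a + b\<bar>\<^sup>2 \<le> 2 * \<bar>a\<bar>\<^sup>2 + 2 * \<bar>b\<bar>\<^sup>2\<close> costs factors in the frame
  constants but makes the approximation argument purely algebraic. The upper bound has to come
  first, through finite partial sums, since it controls the error term in the lower bound.
\<close>

lemma L2_frame_by_density:
  fixes e :: "'i \<Rightarrow> real \<Rightarrow> complex"
  assumes e: "\<And>i. e i \<in> L2" and AB: "A > 0" "B > 0" and D: "D \<subseteq> L2"
    and dense: "\<And>f \<epsilon>. f \<in> L2 \<Longrightarrow> \<epsilon> > 0 \<Longrightarrow> \<exists>h\<in>D. (L2_norm (\<lambda>x. f x - h x))\<^sup>2 < \<epsilon>"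
    and summ: "\<And>h. h \<in> D \<Longrightarrow> (\<lambda>i. (cmod (L2_inner h (e i)))\<^sup>2) summable_on UNIV"
    and lower: "\<And>h. h \<in> D \<Longrightarrow> A * (L2_norm h)\<^sup>2 \<le> (\<Sum>\<^sub>\<infinity>i. (cmod (L2_inner h (e i)))\<^sup>2)"
    and upper: "\<And>h. h \<in> D \<Longrightarrow> (\<Sum>\<^sub>\<infinity>i. (cmod (L2_inner h (e i)))\<^sup>2) \<le> B * (L2_norm h)\<^sup>2"
  shows "L2_frame e"
proof -
  have split: "(cmod (L2_inner f (e i)))\<^sup>2
      \<le> 2 * (cmod (L2_inner (\<lambda>x. f x - h x) (e i)))\<^sup>2 + 2 * (cmod (L2_inner h (e i)))\<^sup>2"
    if "f \<in> L2" "h \<in> L2" for f h i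
    using L2_inner_add[OF L2_diff[OF that] that(2) e, of i] cmod_add_power2_le by simp
  have norm_split: "(L2_norm f)\<^sup>2 \<le> 2 * (L2_norm (\<lambda>x. f x - h x))\<^sup>2 + 2 * (L2_norm h)\<^sup>2"
    if "f \<in> L2" "h \<in> L2" for f h
    using L2_norm_add_le[OF L2_diff[OF that] that(2)] by simp
  have norm_diff: "(L2_norm (\<lambda>x. f x - h x))\<^sup>2 = (L2_norm (\<lambda>x. h x - f x))\<^sup>2" for f h
    using L2_norm_uminus[of "\<lambda>x. f x - h x"] by simp
  have bessel: "(\<Sum>i\<in>F. (cmod (L2_inner f (e i)))\<^sup>2) \<le> 4 * B * (L2_norm f)\<^sup>2"
    if f: "f \<in> L2" and F: "finite F" for f F
  proof -
    define M where "M = (\<Sum>i\<in>F. (L2_norm (e i))\<^sup>2 + 1)"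
    have M: "M \<ge> 0" unfolding M_def by (intro sum_nonneg) (simp add: add_nonneg_nonneg)
    show ?thesis
    proof (rule le_of_le_add_multiple[of "2 * M + 4 * B"])
      show "0 \<le> 2 * M + 4 * B" using M AB by simp
      fix \<epsilon> :: real assume "\<epsilon> > 0"
      then obtain h where h: "h \<in> D" "(L2_norm (\<lambda>x. f x - h x))\<^sup>2 < \<epsilon>"
        using dense[OF f] by blast
      then have hL: "h \<in> L2" using D by auto
      have "(\<Sum>i\<in>F. (cmod (L2_inner f (e i)))\<^sup>2)
          \<le> (\<Sum>i\<in>F. 2 * (\<epsilon> * ((L2_norm (e i))\<^sup>2 + 1)) + 2 * (cmod (L2_inner h (e i)))\<^sup>2)"
      proof (rule sum_mono)
        fix i
        have "(cmod (L2_inner (\<lambda>x. f x - h x) (e i)))\<^sup>2 \<le> (L2_norm (\<lambda>x. f x - h x))\<^sup>2 * ((L2_norm (e i))\<^sup>2 + 1)"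
          by (rule L2_inner_power2_le[OF L2_diff[OF f hL] e])
        also have "\<dots> \<le> \<epsilon> * ((L2_norm (e i))\<^sup>2 + 1)"
          using h(2) by (intro mult_right_mono) (auto simp: add_nonneg_nonneg)
        finally show "(cmod (L2_inner f (e i)))\<^sup>2
            \<le> 2 * (\<epsilon> * ((L2_norm (e i))\<^sup>2 + 1)) + 2 * (cmod (L2_inner h (e i)))\<^sup>2"
          using split[OF f hL, of i] by simp
      qed
      also have "\<dots> = 2 * M * \<epsilon> + 2 * (\<Sum>i\<in>F. (cmod (L2_inner h (e i)))\<^sup>2)"
        unfolding sum.distrib M_def sum_distrib_left[symmetric] by simp
      also have "(\<Sum>i\<in>F. (cmod (L2_inner h (e i)))\<^sup>2) \<le> (\<Sum>\<^sub>\<infinity>i. (cmod (L2_inner h (e i)))\<^sup>2)"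
        by (rule finite_sum_le_infsum[OF summ[OF h(1)] F]) auto
      also have "\<dots> \<le> B * (L2_norm h)\<^sup>2" by (rule upper[OF h(1)])
      also have "(L2_norm h)\<^sup>2 \<le> 2 * \<epsilon> + 2 * (L2_norm f)\<^sup>2"
        using norm_split[OF hL f] h(2) norm_diff[of f h] by simp
      finally show "(\<Sum>i\<in>F. (cmod (L2_inner f (e i)))\<^sup>2) \<le> 4 * B * (L2_norm f)\<^sup>2 + (2 * M + 4 * B) * \<epsilon>"
        using AB by (simp add: algebra_simps)
    qed
  qed
  have summ_all: "(\<lambda>i. (cmod (L2_inner f (e i)))\<^sup>2) summable_on UNIV" if "f \<in> L2" for f
    by (rule nonneg_bdd_above_summable_on)
      (auto intro!: bdd_aboveI2[of _ _ "4 * B * (L2_norm f)\<^sup>2"] bessel that)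
  have upper_all: "(\<Sum>\<^sub>\<infinity>i. (cmod (L2_inner f (e i)))\<^sup>2) \<le> 4 * B * (L2_norm f)\<^sup>2" if "f \<in> L2" for f
    by (rule infsum_le_finite_sums[OF summ_all[OF that]]) (auto intro: bessel that)
  have lower_all: "A / 4 * (L2_norm f)\<^sup>2 \<le> (\<Sum>\<^sub>\<infinity>i. (cmod (L2_inner f (e i)))\<^sup>2)" if f: "f \<in> L2" for f
  proof (rule le_of_le_add_multiple[of "4 * B + A / 2"])
    show "0 \<le> 4 * B + A / 2" using AB by simp
    fix \<epsilon> :: real assume "\<epsilon> > 0"
    then obtain h where h: "h \<in> D" "(L2_norm (\<lambda>x. f x - h x))\<^sup>2 < \<epsilon>"
      using dense[OF f] by blast
    then have hL: "h \<in> L2" using D by auto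
    have "(\<Sum>\<^sub>\<infinity>i. (cmod (L2_inner h (e i)))\<^sup>2)
        \<le> (\<Sum>\<^sub>\<infinity>i. 2 * (cmod (L2_inner (\<lambda>x. h x - f x) (e i)))\<^sup>2 + 2 * (cmod (L2_inner f (e i)))\<^sup>2)"
      by (intro infsum_mono summ[OF h(1)] split[OF hL f] summable_on_add summable_on_cmult_right
          summ_all f L2_diff hL)
    also have "\<dots> = 2 * (\<Sum>\<^sub>\<infinity>i. (cmod (L2_inner (\<lambda>x. h x - f x) (e i)))\<^sup>2)
        + 2 * (\<Sum>\<^sub>\<infinity>i. (cmod (L2_inner f (e i)))\<^sup>2)"
      by (subst infsum_add)
        (auto intro!: summable_on_cmult_right summ_all f L2_diff hL simp: infsum_cmult_right')
    also have "(\<Sum>\<^sub>\<infinity>i. (cmod (L2_inner (\<lambda>x. h x - f x) (e i)))\<^sup>2) \<le> 4 * B * (L2_norm (\<lambda>x. h x - f x))\<^sup>2"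
      by (intro upper_all L2_diff hL f)
    also have "4 * B * (L2_norm (\<lambda>x. h x - f x))\<^sup>2 \<le> 4 * B * \<epsilon>"
      using h(2) AB norm_diff[of f h] by (intro mult_left_mono) auto
    finally have "A * (L2_norm h)\<^sup>2 \<le> 8 * B * \<epsilon> + 2 * (\<Sum>\<^sub>\<infinity>i. (cmod (L2_inner f (e i)))\<^sup>2)"
      using lower[OF h(1)] by simp
    moreover have "A * (L2_norm f)\<^sup>2 \<le> A * (2 * \<epsilon> + 2 * (L2_norm h)\<^sup>2)"
      using norm_split[OF f hL] h(2) AB by (intro mult_left_mono) auto
    ultimately show "A / 4 * (L2_norm f)\<^sup>2
        \<le> (\<Sum>\<^sub>\<infinity>i. (cmod (L2_inner f (e i)))\<^sup>2) + (4 * B + A / 2) * \<epsilon>"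
      by (simp add: algebra_simps)
  qed
  show ?thesis
    unfolding L2_frame_def
    using e AB summ_all upper_all lower_all
    by (intro conjI allI exI[of _ "A / 4"] exI[of _ "4 * B"] ballI) auto
qed

definition continuous_compactly_supported :: "(real \<Rightarrow> complex) set" where
  "continuous_compactly_supported = {f. continuous_on UNIV f \<and> (\<exists>R. \<forall>x. R < \<bar>x\<bar> \<longrightarrow> f x = 0)}"

lemma continuous_compactly_supported_L2: "continuous_compactly_supported \<subseteq> L2"
proof
  fix f assume "f \<in> continuous_compactly_supported"
  then obtain R where f: "continuous_on UNIV f" "\<And>x. R < \<bar>x\<bar> \<Longrightarrow> f x = 0"
    by (auto simp: continuous_compactly_supported_def)
  have "integrable lborel (\<lambda>x. (cmod (f x))\<^sup>2)"
    by (rule integrable_compact_support[of _ R]) (auto intro!: continuous_intros f)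
  then show "f \<in> L2"
    using borel_measurable_continuous_onI[OF f(1)] by (simp add: L2_def)
qed

text \<open>
  Truncating both the domain and the values.
\<close>

lemma L2_dense_bounded:
  assumes f: "f \<in> L2" and \<epsilon>: "\<epsilon> > 0"
  obtains n :: nat and h where "h \<in> L2" "\<And>x. cmod (h x) \<le> real n" "\<And>x. real n < \<bar>x\<bar> \<Longrightarrow> h x = 0"
    "(L2_norm (\<lambda>x. f x - h x))\<^sup>2 < \<epsilon>"
proof -
  note [measurable] = L2_measurable[OF f]
  define F where "F n x = (if \<bar>x\<bar> \<le> real n \<and> cmod (f x) \<le> real n then f x else 0)" for n x
  have [measurable]: "F n \<in> borel_measurable borel" for n
    unfolding F_def[abs_def] by measurable
  have "(\<lambda>n. LINT x|lborel. (cmod (f x - F n x))\<^sup>2) \<longlonglongrightarrow> integral\<^sup>L lborel (\<lambda>x::real. 0::real)"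
  proof (rule integral_dominated_convergence[where w = "\<lambda>x. (cmod (f x))\<^sup>2"])
    show "AE x in lborel. (\<lambda>n. (cmod (f x - F n x))\<^sup>2) \<longlonglongrightarrow> 0"
    proof (intro AE_I2 tendsto_eventually)
      fix x
      obtain N where "max \<bar>x\<bar> (cmod (f x)) \<le> real N" using real_arch_simple by blast
      then show "\<forall>\<^sub>F n in sequentially. (cmod (f x - F n x))\<^sup>2 = 0"
        by (intro eventually_sequentiallyI[of N]) (auto simp: F_def)
    qed
  qed (auto simp: F_def L2_integrable[OF f])
  then have "\<forall>\<^sub>F n in sequentially. (LINT x|lborel. (cmod (f x - F n x))\<^sup>2) < \<epsilon>"
    using \<epsilon> by (intro order_tendstoD(2)) auto
  then obtain n where n: "(L2_norm (\<lambda>x. f x - F n x))\<^sup>2 < \<epsilon>"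
    by (auto simp: L2_norm_power2 dest: eventually_happens)
  have "F n \<in> L2"
    unfolding L2_def
    using Bochner_Integration.integrable_bound[OF L2_integrable[OF f], of "\<lambda>x. (cmod (F n x))\<^sup>2"]
    by (auto simp: F_def)
  then show ?thesis
    using n by (intro that[of "F n" n]) (auto simp: F_def)
qed

text \<open>
  A measurable function is almost everywhere a limit of continuous ones. Projecting their values
  onto a disc and multiplying with a continuous cutoff gives continuous functions of compact
  support with the same limit and a common integrable bound.
\<close>

lemma bounded_approx_continuous:
  assumes h: "h \<in> L2" "\<And>x. cmod (h x) \<le> real n" "\<And>x. real n < \<bar>x\<bar> \<Longrightarrow> h x = 0" and \<epsilon>: "\<epsilon> > 0"
  shows "\<exists>w\<in>continuous_compactly_supported. (L2_norm (\<lambda>x. h x - w x))\<^sup>2 < \<epsilon>"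
proof -
  note [measurable] = L2_measurable[OF h(1)]
  have "h \<in> borel_measurable lebesgue"
    by (rule measurable_completion) measurable
  then have "h measurable_on UNIV"
    by (rule lebesgue_measurable_imp_measurable_on) simp
  then obtain N w where N: "negligible N" and w_cont: "\<And>k. continuous_on UNIV (w k)"
    and w_lim: "\<And>x. x \<notin> N \<Longrightarrow> (\<lambda>k. w k x) \<longlonglongrightarrow> h x"
    unfolding measurable_on_def by (auto split: if_splits)
  define cutoff where "cutoff x = max 0 (min 1 (real n + 1 - \<bar>x\<bar>))" for x
  define p where "p = closest_point (cball (0::complex) (real n))"
  define v where "v k x = of_real (cutoff x) * p (w k x)" for k x
  have p_cont: "continuous_on A p" for A
    unfolding p_def by (rule continuous_on_closest_point) auto
  have p_le: "cmod (p z) \<le> real n" for z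
    using closest_point_in_set[of "cball (0::complex) (real n)" z] by (simp add: p_def)
  have v_cont: "continuous_on UNIV (v k)" for k
    unfolding v_def[abs_def] cutoff_def
    by (intro continuous_intros continuous_on_compose2[OF p_cont w_cont]) auto
  have v_zero: "v k x = 0" if "real n + 1 < \<bar>x\<bar>" for k x
    using that by (simp add: v_def cutoff_def)
  have v_le: "cmod (v k x) \<le> real n" for k x
  proof -
    have "cmod (v k x) = cutoff x * cmod (p (w k x))" by (simp add: v_def norm_mult cutoff_def)
    also have "\<dots> \<le> 1 * real n" by (intro mult_mono p_le) (auto simp: cutoff_def)
    finally show ?thesis by simp
  qed
  have v_lim: "(\<lambda>k. v k x) \<longlonglongrightarrow> h x" if "x \<notin> N" for x
  proof (cases "real n < \<bar>x\<bar>")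
    case False
    have "(\<lambda>k. p (w k x)) \<longlonglongrightarrow> p (h x)"
      using continuous_on_tendsto_compose[OF p_cont[of UNIV] w_lim[OF that]] by simp
    moreover have "p (h x) = h x" using h(2) by (simp add: p_def closest_point_self)
    ultimately show ?thesis using False by (simp add: v_def cutoff_def)
  next
    case True
    have "(\<lambda>k. p (w k x)) \<longlonglongrightarrow> p (h x)"
      using continuous_on_tendsto_compose[OF p_cont[of UNIV] w_lim[OF that]] by simp
    moreover have "p (h x) = 0" using h(3)[OF True] by (simp add: p_def closest_point_self)
    ultimately show ?thesis
      using h(3)[OF True] by (auto simp: v_def intro: tendsto_mult_right_zero)
  qed
  have [measurable]: "v k \<in> borel_measurable borel" for k
    by (rule borel_measurable_continuous_onI[OF v_cont])
  have "(\<lambda>k. LINT x|lborel. (cmod (h x - v k x))\<^sup>2) \<longlonglongrightarrow> integral\<^sup>L lborel (\<lambda>x::real. 0::real)"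
  proof (rule integral_dominated_convergence)
    show "integrable lborel (\<lambda>x. indicator {-real n - 1..real n + 1} x *\<^sub>R (2 * real n)\<^sup>2)"
      by (rule borel_integrable_compact) auto
    show "AE x in lborel. norm ((cmod (h x - v k x))\<^sup>2)
        \<le> indicator {-real n - 1..real n + 1} x *\<^sub>R (2 * real n)\<^sup>2" for k
    proof (intro AE_I2)
      fix x
      show "norm ((cmod (h x - v k x))\<^sup>2) \<le> indicator {-real n - 1..real n + 1} x *\<^sub>R (2 * real n)\<^sup>2"
      proof (cases "real n + 1 < \<bar>x\<bar>")
        case True
        then show ?thesis using h(3)[of x] v_zero[of x k] by simp
      next
        case False
        have "cmod (h x - v k x) \<le> 2 * real n"
          using norm_triangle_ineq4[of "h x" "v k x"] h(2)[of x] v_le[of k x] by linarith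
        then have "(cmod (h x - v k x))\<^sup>2 \<le> (2 * real n)\<^sup>2" by (intro power_mono) auto
        moreover have "x \<in> {-real n - 1..real n + 1}" using False by auto
        ultimately show ?thesis by simp
      qed
    qed
    have "AE x in lborel. x \<notin> N"
      using N AE_not_in[of N lebesgue] unfolding negligible_iff_null_sets AE_completion_iff by simp
    then show "AE x in lborel. (\<lambda>k. (cmod (h x - v k x))\<^sup>2) \<longlonglongrightarrow> 0"
    proof eventually_elim
      case (elim x)
      have "(\<lambda>k. (cmod (h x - v k x))\<^sup>2) \<longlonglongrightarrow> (cmod (h x - h x))\<^sup>2"
        by (intro tendsto_intros v_lim elim)
      then show ?case by simp
    qed
  qed measurable
  then have "\<forall>\<^sub>F k in sequentially. (LINT x|lborel. (cmod (h x - v k x))\<^sup>2) < \<epsilon>"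
    using \<epsilon> by (intro order_tendstoD(2)) auto
  then obtain k where "(L2_norm (\<lambda>x. h x - v k x))\<^sup>2 < \<epsilon>"
    by (auto simp: L2_norm_power2 dest: eventually_happens)
  moreover have "v k \<in> continuous_compactly_supported"
    using v_cont v_zero by (auto simp: continuous_compactly_supported_def)
  ultimately show ?thesis by blast
qed

lemma L2_dense_continuous:
  assumes f: "f \<in> L2" and \<epsilon>: "\<epsilon> > 0"
  shows "\<exists>w\<in>continuous_compactly_supported. (L2_norm (\<lambda>x. f x - w x))\<^sup>2 < \<epsilon>"
proof -
  obtain n :: nat and h where h: "h \<in> L2" "\<And>x. cmod (h x) \<le> real n" "\<And>x. real n < \<bar>x\<bar> \<Longrightarrow> h x = 0"
      "(L2_norm (\<lambda>x. f x - h x))\<^sup>2 < \<epsilon> / 4"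
    using L2_dense_bounded[OF f, of "\<epsilon> / 4"] \<epsilon> by (metis divide_pos_pos zero_less_numeral)
  obtain w where w: "w \<in> continuous_compactly_supported" "(L2_norm (\<lambda>x. h x - w x))\<^sup>2 < \<epsilon> / 4"
    using bounded_approx_continuous[OF h(1-3), of "\<epsilon> / 4"] \<epsilon> by auto
  have "w \<in> L2" using w(1) continuous_compactly_supported_L2 by auto
  then have "(L2_norm (\<lambda>x. f x - w x))\<^sup>2 < \<epsilon>"
    using L2_norm_add_le[OF L2_diff[OF f h(1)] L2_diff[OF h(1)], of w] h(4) w(2) by simp
  then show ?thesis using w(1) by blast
qed

lemma gabor_system_L2:
  assumes g: "g \<in> L2" and cont: "continuous_on UNIV g"
  shows "gabor_system g \<alpha> \<beta> i \<in> L2"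
proof -
  obtain m k where i: "i = (m, k)" by (cases i)
  have "continuous_on UNIV (gabor_system g \<alpha> \<beta> i)"
    unfolding i gabor_system_def
    by (auto intro!: continuous_intros continuous_on_compose2[OF cont])
  moreover have "integrable lborel (\<lambda>x. (cmod (gabor_system g \<alpha> \<beta> i x))\<^sup>2)"
    using lborel_integrable_real_affine[OF L2_integrable[OF g], of 1 "- \<alpha> * of_int k"]
    by (simp add: i gabor_system_def norm_mult)
  ultimately show ?thesis
    by (simp add: L2_def borel_measurable_continuous_onI)
qed

lemma (in dominant_spectrum) gabor_frame:
  assumes g: "g \<in> L2" and cont: "continuous_on UNIV g"
  shows "L2_frame (gabor_system g \<alpha> \<beta>)"
proof -
  obtain A B where AB: "A > 0" "B > 0" and bounds:
    "\<And>f R. continuous_on UNIV f \<Longrightarrow> (\<And>x. R < \<bar>x\<bar> \<Longrightarrow> f x = 0) \<Longrightarrow>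
      (\<lambda>i. (cmod (L2_inner f (gabor_system g \<alpha> \<beta> i)))\<^sup>2) summable_on UNIV \<and>
      A * (L2_norm f)\<^sup>2 \<le> (\<Sum>\<^sub>\<infinity>i. (cmod (L2_inner f (gabor_system g \<alpha> \<beta> i)))\<^sup>2) \<and>
      (\<Sum>\<^sub>\<infinity>i. (cmod (L2_inner f (gabor_system g \<alpha> \<beta> i)))\<^sup>2) \<le> B * (L2_norm f)\<^sup>2"
    using gabor_bounds_compact_support[OF cont] by blast
  have bounds': "(\<lambda>i. (cmod (L2_inner f (gabor_system g \<alpha> \<beta> i)))\<^sup>2) summable_on UNIV \<and>
      A * (L2_norm f)\<^sup>2 \<le> (\<Sum>\<^sub>\<infinity>i. (cmod (L2_inner f (gabor_system g \<alpha> \<beta> i)))\<^sup>2) \<and>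
      (\<Sum>\<^sub>\<infinity>i. (cmod (L2_inner f (gabor_system g \<alpha> \<beta> i)))\<^sup>2) \<le> B * (L2_norm f)\<^sup>2"
    if f: "f \<in> continuous_compactly_supported" for f
  proof -
    obtain R where "continuous_on UNIV f" "\<And>x. R < \<bar>x\<bar> \<Longrightarrow> f x = 0"
      using f by (auto simp: continuous_compactly_supported_def)
    then show ?thesis by (rule bounds)
  qed
  show ?thesis
    by (rule L2_frame_by_density[OF gabor_system_L2[OF g cont] AB
          continuous_compactly_supported_L2 L2_dense_continuous])
      (use bounds' in blast)+
qed

section \<open>Fourier transform of two-sided exponentials\<close>

text \<open>
  Improper integrals of positive functions through an antiderivative; this covers both
  \<open>exp (- a * \<bar>x\<bar>)\<close> and \<open>1 / (1 + x\<^sup>2)\<close>.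
\<close>

lemma integrable_even_extension:
  fixes f F :: "real \<Rightarrow> real"
  assumes f: "f \<in> borel_measurable borel"
    and deriv: "\<And>x. 0 \<le> x \<Longrightarrow> DERIV F x :> f x" and nonneg: "\<And>x. 0 \<le> x \<Longrightarrow> 0 \<le> f x"
    and lim: "(F \<longlongrightarrow> T) at_top"
  shows "integrable lborel (\<lambda>x. f \<bar>x\<bar>)"
proof -
  note [measurable] = f
  define h where "h x = f x * indicator {0..} x" for x
  have "(\<integral>\<^sup>+x. ennreal (f x) * indicator {0..} x \<partial>lborel) = ennreal (T - F 0)"
    by (rule nn_integral_FTC_atLeast[OF f deriv nonneg lim])
  then have "(\<integral>\<^sup>+x. ennreal (h x) \<partial>lborel) < \<infinity>"
    by (simp add: h_def nn_integral_set_ennreal)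
  moreover have h_nonneg: "0 \<le> h x" for x using nonneg by (simp add: h_def indicator_def)
  ultimately have h: "integrable lborel h"
    unfolding integrable_iff_bounded by (auto simp: h_def[abs_def])
  then have "integrable lborel (\<lambda>x. h x + h (0 + (-1) * x))"
    by (intro Bochner_Integration.integrable_add lborel_integrable_real_affine) auto
  then show ?thesis
  proof (rule Bochner_Integration.integrable_bound)
    show "AE x in lborel. norm (f \<bar>x\<bar>) \<le> norm (h x + h (0 + (-1) * x))"
    proof (intro AE_I2)
      fix x :: real
      have "f \<bar>x\<bar> \<le> h x + h (- x)"
        using h_nonneg[of x] h_nonneg[of "- x"] by (cases "x \<ge> 0") (auto simp: h_def)
      then show "norm (f \<bar>x\<bar>) \<le> norm (h x + h (0 + (-1) * x))"
        using nonneg[of "\<bar>x\<bar>"] by simp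
    qed
  qed measurable
qed

lemma integrable_exp_abs:
  assumes "a > 0"
  shows "integrable lborel (\<lambda>x::real. exp (- a * \<bar>x\<bar>))"
proof (rule integrable_even_extension[where F = "\<lambda>x. - exp (- a * x) / a" and T = 0])
  show "((\<lambda>x. - exp (- a * x) / a) \<longlongrightarrow> 0) at_top"
  proof -
    have "filterlim (\<lambda>x. a * x) at_top at_top"
      using assms by (intro filterlim_tendsto_pos_mult_at_top[OF tendsto_const] filterlim_ident)
    then have "((\<lambda>x. exp (- (a * x))) \<longlongrightarrow> 0) at_top"
      by (intro filterlim_compose[OF exp_at_bot] filterlim_compose[OF filterlim_uminus_at_bot_at_top])
    then have "((\<lambda>x. - exp (- (a * x)) / a) \<longlongrightarrow> - 0 / a) at_top"
      using assms by (intro tendsto_intros) auto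
    then show ?thesis by simp
  qed
qed (use assms in \<open>auto intro!: derivative_eq_intros\<close>)

lemma exp_has_integral_Icc:
  fixes z :: complex
  assumes "z \<noteq> 0" "a \<le> b"
  shows "((\<lambda>\<xi>. exp (z * of_real \<xi>)) has_integral (exp (z * of_real b) - exp (z * of_real a)) / z) {a..b}"
proof -
  have "((\<lambda>\<xi>. exp (z * of_real \<xi>)) has_integral (exp (z * of_real b) / z - exp (z * of_real a) / z)) {a..b}"
  proof (rule fundamental_theorem_of_calculus[OF assms(2)])
    fix \<xi> :: real
    have "((\<lambda>w. exp (z * w) / z) has_field_derivative exp (z * of_real \<xi>)) (at (of_real \<xi>))"
      using assms(1) by (auto intro!: derivative_eq_intros)
    then show "((\<lambda>\<xi>. exp (z * of_real \<xi>) / z) has_vector_derivative exp (z * of_real \<xi>)) (at \<xi> within {a..b})"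
      by (rule has_vector_derivative_real_field)
  qed
  then show ?thesis by (simp add: diff_divide_distrib)
qed

text \<open>
  On each half-line the integrand is an exponential with complex rate \<open>z\<close> or its conjugate, so the
  integral is \<open>1 / z + 1 / cnj z\<close>.
\<close>

lemma fourier_exp_abs:
  fixes a b :: real
  assumes a: "a > 0"
  shows "(LINT \<xi>|lborel. of_real (exp (- a * \<bar>\<xi>\<bar>)) * cis (b * \<xi>)) = of_real (2 * a / (a\<^sup>2 + b\<^sup>2))"
proof -
  define v where "v \<xi> = complex_of_real (exp (- a * \<bar>\<xi>\<bar>)) * cis (b * \<xi>)" for \<xi>
  define z where "z = Complex a b"
  have z: "z \<noteq> 0" "cnj z \<noteq> 0" using a by (auto simp: z_def complex_eq_iff)
  have v_int: "integrable lborel v"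
    unfolding v_def[abs_def]
    by (intro cis_mult_integrable integrable_of_real integrable_exp_abs a)
  have v_pos: "v \<xi> = exp (- cnj z * of_real \<xi>)" if "\<xi> \<ge> 0" for \<xi>
    using that by (simp add: v_def z_def complex_eq_iff Re_exp Im_exp)
  have v_neg: "v \<xi> = exp (z * of_real \<xi>)" if "\<xi> \<le> 0" for \<xi>
    using that by (simp add: v_def z_def complex_eq_iff Re_exp Im_exp)
  have Icc: "integral {- real n..real n} v = 1 / z + 1 / cnj z - exp (- z * n) / z - exp (- cnj z * n) / cnj z" for n :: nat
  proof -
    have "(v has_integral ((exp (z * of_real 0) - exp (z * of_real (- real n))) / z)) {- real n..0}"
      using has_integral_eq[OF _ exp_has_integral_Icc[OF z(1), of "- real n" 0], of v] v_neg by simp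
    moreover have "(v has_integral ((exp (- cnj z * of_real (real n)) - exp (- cnj z * of_real 0)) / (- cnj z))) {0..real n}"
      using has_integral_eq[OF _ exp_has_integral_Icc[of "- cnj z" 0 "real n"], of v] v_pos z by simp
    ultimately have "(v has_integral ((exp (z * of_real 0) - exp (z * of_real (- real n))) / z
        + (exp (- cnj z * of_real (real n)) - exp (- cnj z * of_real 0)) / (- cnj z))) {- real n..real n}"
      by (intro has_integral_combine[of "- real n" 0 "real n" v]) auto
    then have "integral {- real n..real n} v = (exp (z * of_real 0) - exp (z * of_real (- real n))) / z
        + (exp (- cnj z * of_real (real n)) - exp (- cnj z * of_real 0)) / (- cnj z)"
      by (rule integral_unique)
    then show ?thesis by (simp add: diff_divide_distrib)
  qed
  have decay: "(\<lambda>n. exp (- w * of_nat n) / w) \<longlonglongrightarrow> 0" if "Re w = a" for w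
  proof -
    have "(\<lambda>n. exp (- a) ^ n / cmod w) \<longlonglongrightarrow> 0 / cmod w"
      using a that by (intro tendsto_divide LIMSEQ_power_zero tendsto_const) auto
    moreover have "norm (exp (- w * of_nat n) / w) = exp (- a) ^ n / cmod w" for n
      using that by (simp add: norm_divide exp_of_nat_mult[symmetric] mult.commute)
    ultimately show ?thesis
      by (subst tendsto_norm_zero_iff[symmetric]) simp
  qed
  have lim1: "(\<lambda>n. integral {- real n..real n} v) \<longlonglongrightarrow> 1 / z + 1 / cnj z - 0 - 0"
    unfolding Icc by (intro tendsto_diff tendsto_const decay) (auto simp: z_def)
  have lim2: "(\<lambda>n. integral {- real n..real n} v) \<longlonglongrightarrow> (LINT \<xi>|lborel. v \<xi>)"
  proof -
    have set_int: "set_integrable lborel {- real n..real n} v" for n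
      using integrable_mult_indicator[of "{- real n..real n}" lborel v] v_int
      by (simp add: set_integrable_def)
    have "(\<lambda>n. LINT \<xi>|lborel. indicator {- real n..real n} \<xi> *\<^sub>R v \<xi>) \<longlonglongrightarrow> (LINT \<xi>|lborel. v \<xi>)"
    proof (rule integral_dominated_convergence[where w = "\<lambda>\<xi>. cmod (v \<xi>)"])
      show "AE \<xi> in lborel. (\<lambda>n. indicator {- real n..real n} \<xi> *\<^sub>R v \<xi>) \<longlonglongrightarrow> v \<xi>"
      proof (intro AE_I2 tendsto_eventually)
        fix \<xi> :: real
        obtain N where "\<bar>\<xi>\<bar> \<le> real N" using real_arch_simple by blast
        then show "\<forall>\<^sub>F n in sequentially. indicator {- real n..real n} \<xi> *\<^sub>R v \<xi> = v \<xi>"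
          by (intro eventually_sequentiallyI[of N]) (auto simp: indicator_def abs_le_iff)
      qed
    qed (use v_int in \<open>auto simp: indicator_def intro: borel_measurable_integrable integrable_norm\<close>)
    then show ?thesis
      using set_borel_integral_eq_integral(2)[OF set_int] by (simp add: set_lebesgue_integral_def)
  qed
  have "(LINT \<xi>|lborel. v \<xi>) = 1 / z + 1 / cnj z"
    using LIMSEQ_unique[OF lim2 lim1] by simp
  also have "\<dots> = (z + cnj z) / (z * cnj z)"
    using z by (simp add: field_simps)
  also have "\<dots> = of_real (2 * a / (a\<^sup>2 + b\<^sup>2))"
    by (simp add: z_def complex_mult_cnj complex_add_cnj)
  finally show ?thesis by (simp add: v_def[abs_def])
qed

lemma has_sum_geometric_int:
  fixes r :: real
  assumes r: "0 \<le> r" "r < 1"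
  shows "((\<lambda>l. r ^ nat \<bar>l\<bar>) has_sum (2 * (r / (1 - r)))) (-{0})"
proof -
  have base: "((\<lambda>n. r ^ n) has_sum (r / (1 - r))) {1..}"
    by (rule has_sum_geometric_from_1) (use r in simp)
  have "((\<lambda>l. r ^ nat \<bar>l\<bar>) has_sum (r / (1 - r))) {0<..}"
    using base by (subst has_sum_reindex_bij_witness[of _ int nat]) auto
  moreover have "((\<lambda>l. r ^ nat \<bar>l\<bar>) has_sum (r / (1 - r))) {..<0}"
    using base by (subst has_sum_reindex_bij_witness[of _ "\<lambda>n. - int n" "\<lambda>l. nat (- l)"]) auto
  ultimately have "((\<lambda>l. r ^ nat \<bar>l\<bar>) has_sum (r / (1 - r) + r / (1 - r))) ({0<..} \<union> {..<0})"
    by (rule has_sum_Un_disjoint) auto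
  moreover have "{0<..} \<union> {..<0} = (-{0} :: int set)" by auto
  ultimately show ?thesis by simp
qed

lemma summable_on_geometric_int:
  fixes r :: real
  assumes r: "0 \<le> r" "r < 1"
  shows "(\<lambda>l::int. r ^ nat \<bar>l\<bar>) summable_on UNIV"
proof -
  have "(\<lambda>l::int. r ^ nat \<bar>l\<bar>) summable_on insert 0 (-{0})"
    using has_sum_imp_summable[OF has_sum_geometric_int[OF r]] by (simp add: summable_on_insert_iff)
  moreover have "insert 0 (-{0}) = (UNIV :: int set)" by auto
  ultimately show ?thesis by simp
qed

section \<open>The rational window\<close>

text \<open>
  The Fourier transform of the window. Its modulus is \<open>pi / 12 * (u * (1 - u)\<^sup>2)\<close> with
  \<open>u = exp (- 2 * pi * \<bar>\<xi>\<bar>)\<close>: the coefficients of the three exponentials are in the ratio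
  \<open>1 : -2 : 1\<close>, which gives a double zero at the origin.
\<close>

definition spectrum :: "real \<Rightarrow> complex" where
  "spectrum \<xi> = of_real (- (pi / 12) * (exp (- (2 * pi) * \<bar>\<xi>\<bar>) * (1 - exp (- (2 * pi) * \<bar>\<xi>\<bar>))\<^sup>2))"

lemma spectrum_expand:
  "spectrum \<xi> = - (pi / 12) * (of_real (exp (- (2 * pi) * \<bar>\<xi>\<bar>))
    - 2 * of_real (exp (- (4 * pi) * \<bar>\<xi>\<bar>)) + of_real (exp (- (6 * pi) * \<bar>\<xi>\<bar>)))"
proof -
  define u where "u = exp (- (2 * pi) * \<bar>\<xi>\<bar>)"
  have u2: "exp (- (4 * pi) * \<bar>\<xi>\<bar>) = u ^ 2" and u3: "exp (- (6 * pi) * \<bar>\<xi>\<bar>) = u ^ 3"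
    unfolding u_def exp_of_nat_mult[symmetric] by (simp_all add: algebra_simps)
  show ?thesis
    unfolding spectrum_def u2 u3 u_def[symmetric]
    by (simp add: power2_eq_square power3_eq_cube algebra_simps)
qed

lemma spectrum_integrable: "integrable lborel spectrum"
  unfolding spectrum_expand[abs_def]
  by (intro integrable_mult_right Bochner_Integration.integrable_add Bochner_Integration.integrable_diff
      integrable_of_real integrable_exp_abs) auto

lemma spectrum_continuous: "continuous_on UNIV spectrum"
  unfolding spectrum_def[abs_def] by (intro continuous_intros)

text \<open>
  Partial fractions: the three exponentials transform into multiples of \<open>1 / (t\<^sup>2 + 1)\<close>,
  \<open>1 / (t\<^sup>2 + 4)\<close> and \<open>1 / (t\<^sup>2 + 9)\<close>.
\<close>

lemma window_eq_fourier: "window t = (LINT \<xi>|lborel. spectrum \<xi> * cis (2 * pi * \<xi> * t))"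
proof -
  define E where "E a \<xi> = complex_of_real (exp (- a * \<bar>\<xi>\<bar>)) * cis (2 * pi * t * \<xi>)" for a \<xi>
  have E_int: "integrable lborel (E a)" if "a > 0" for a
    unfolding E_def[abs_def] by (intro cis_mult_integrable integrable_of_real integrable_exp_abs that)
  have E: "(LINT \<xi>|lborel. E (2 * pi * w) \<xi>) = of_real (w / (pi * (w\<^sup>2 + t\<^sup>2)))" if "w > 0" for w
  proof -
    have "2 * (2 * pi * w) / ((2 * pi * w)\<^sup>2 + (2 * pi * t)\<^sup>2) = w / (pi * (w\<^sup>2 + t\<^sup>2))"
    proof -
      have "(2 * pi * w)\<^sup>2 + (2 * pi * t)\<^sup>2 = (4 * pi) * (pi * (w\<^sup>2 + t\<^sup>2))"
        by (simp add: power2_eq_square algebra_simps)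
      then show ?thesis by simp
    qed
    then show ?thesis
      unfolding E_def using fourier_exp_abs[of "2 * pi * w" "2 * pi * t"] that by simp
  qed
  have "spectrum \<xi> * cis (2 * pi * \<xi> * t)
      = - (pi / 12) * (E (2 * pi * 1) \<xi> - 2 * E (2 * pi * 2) \<xi> + E (2 * pi * 3) \<xi>)" for \<xi>
    unfolding spectrum_expand E_def by (simp add: algebra_simps)
  then have "(LINT \<xi>|lborel. spectrum \<xi> * cis (2 * pi * \<xi> * t))
      = - (pi / 12) * ((LINT \<xi>|lborel. E (2 * pi * 1) \<xi>) - 2 * (LINT \<xi>|lborel. E (2 * pi * 2) \<xi>)
          + (LINT \<xi>|lborel. E (2 * pi * 3) \<xi>))"
    using E_int[of "2 * pi * 1"] E_int[of "2 * pi * 2"] E_int[of "2 * pi * 3"] by simp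
  also have "\<dots> = of_real (- (pi / 12) * (1 / (pi * (1\<^sup>2 + t\<^sup>2)) - 2 * (2 / (pi * (2\<^sup>2 + t\<^sup>2))) + 3 / (pi * (3\<^sup>2 + t\<^sup>2))))"
    using E[of 1] E[of 2] E[of 3] by simp
  also have "- (pi / 12) * (1 / (pi * (1\<^sup>2 + t\<^sup>2)) - 2 * (2 / (pi * (2\<^sup>2 + t\<^sup>2))) + 3 / (pi * (3\<^sup>2 + t\<^sup>2)))
      = (t\<^sup>2 - 1) / ((t\<^sup>2 + 1) * (t\<^sup>2 + 4) * (t\<^sup>2 + 9))"
  proof -
    define y where "y = t\<^sup>2"
    have y: "y + 1 \<noteq> 0" "y + 4 \<noteq> 0" "y + 9 \<noteq> 0"
      using zero_le_power2[of t] unfolding y_def by linarith+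
    have "- (pi / 12) * (1 / (pi * (1\<^sup>2 + y)) - 2 * (2 / (pi * (2\<^sup>2 + y))) + 3 / (pi * (3\<^sup>2 + y)))
        = - (1 / 12) * (1 / (y + 1) - 4 / (y + 4) + 3 / (y + 9))"
    proof -
      have factor: "w / (pi * (v + y)) = w / (y + v) / pi" for w v
        by (simp add: add.commute mult.commute)
      have cancel: "- (pi / 12) * (a / pi - 2 * (b / pi) + c / pi) = - (1 / 12) * (a - 2 * b + c)" for a b c
        by (simp add: field_simps)
      show ?thesis unfolding factor cancel by simp
    qed
    also have "\<dots> = (y - 1) / ((y + 1) * (y + 4) * (y + 9))"
      using y by (simp add: divide_simps) (simp add: algebra_simps)
    finally show ?thesis by (simp add: y_def)
  qed
  finally show ?thesis by (simp add: window_def)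
qed

lemma window_continuous: "continuous_on UNIV window"
proof -
  have "(x\<^sup>2 + 1) * (x\<^sup>2 + 4) * (x\<^sup>2 + 9) \<noteq> 0" for x :: real
    by (simp add: add_nonneg_eq_0_iff)
  then show ?thesis
    unfolding window_def[abs_def] by (intro continuous_intros) auto
qed

lemma window_L2: "window \<in> L2"
proof -
  have "integrable lborel (\<lambda>x::real. inverse (1 + \<bar>x\<bar>\<^sup>2))"
    by (rule integrable_even_extension[where F = arctan and T = "pi / 2"])
      (auto intro: DERIV_arctan tendsto_arctan_at_top)
  then have "integrable lborel (\<lambda>x. (cmod (window x))\<^sup>2)"
  proof (rule Bochner_Integration.integrable_bound)
    have "window \<in> borel_measurable borel"
      by (rule borel_measurable_continuous_onI[OF window_continuous])
    then show "(\<lambda>x. (cmod (window x))\<^sup>2) \<in> borel_measurable lborel" by measurable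
    show "AE x in lborel. norm ((cmod (window x))\<^sup>2) \<le> norm (inverse (1 + \<bar>x\<bar>\<^sup>2))"
    proof (intro AE_I2)
      fix x :: real
      define y where "y = x\<^sup>2"
      have y: "y \<ge> 0" by (simp add: y_def)
      have "cmod (window x) = \<bar>y - 1\<bar> / ((y + 1) * (y + 4) * (y + 9))"
        using y unfolding window_def norm_of_real y_def[symmetric] by (simp add: abs_mult)
      also have "\<dots> \<le> ((y + 4) * (y + 9)) / ((y + 1) * (y + 4) * (y + 9))"
      proof (intro divide_right_mono)
        have "\<bar>y - 1\<bar> \<le> (y + 4) * 1" using y by (simp add: abs_le_iff)
        also have "\<dots> \<le> (y + 4) * (y + 9)" using y by (intro mult_left_mono) auto
        finally show "\<bar>y - 1\<bar> \<le> (y + 4) * (y + 9)" .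
      qed (use y in simp)
      also have "\<dots> = 1 / (y + 1)" using y by simp
      finally have le: "cmod (window x) \<le> 1 / (y + 1)" .
      also have "\<dots> \<le> 1" using y by simp
      finally have "(cmod (window x))\<^sup>2 \<le> cmod (window x) * 1"
        unfolding power2_eq_square by (intro mult_left_mono) auto
      also have "\<dots> \<le> inverse (1 + y)" using le by (simp add: field_simps)
      finally show "norm ((cmod (window x))\<^sup>2) \<le> norm (inverse (1 + \<bar>x\<bar>\<^sup>2))"
        using y by (simp add: y_def)
    qed
  qed
  then show ?thesis
    using borel_measurable_continuous_onI[OF window_continuous] by (simp add: L2_def)
qed

lemma cmod_spectrum:
  "cmod (spectrum \<xi>) = pi / 12 * (exp (- (2 * pi) * \<bar>\<xi>\<bar>) * (1 - exp (- (2 * pi) * \<bar>\<xi>\<bar>))\<^sup>2)"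
  unfolding spectrum_def norm_of_real by (simp add: abs_mult)

lemma spectrum_upper: "cmod (spectrum \<xi>) \<le> pi / 12 * exp (- (2 * pi) * \<bar>\<xi>\<bar>)"
proof -
  have "(1 - exp (- (2 * pi) * \<bar>\<xi>\<bar>))\<^sup>2 \<le> 1"
    by (rule power_le_one) auto
  then have "exp (- (2 * pi) * \<bar>\<xi>\<bar>) * (1 - exp (- (2 * pi) * \<bar>\<xi>\<bar>))\<^sup>2 \<le> exp (- (2 * pi) * \<bar>\<xi>\<bar>) * 1"
    by (rule mult_left_mono) simp
  then show ?thesis
    unfolding cmod_spectrum by (intro mult_left_mono) auto
qed

text \<open>
  A shift by \<open>l / \<alpha>\<close> moves a point with \<open>\<bar>\<xi>\<bar> \<le> t\<close> to distance at least \<open>\<bar>l\<bar> / \<alpha> - t\<close> from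
  the origin, so the translates of the spectrum decay geometrically.
\<close>

lemma spectrum_upper_shift:
  assumes "\<bar>\<xi>\<bar> \<le> t" "\<alpha> > 0"
  shows "cmod (spectrum (\<xi> + of_int l / \<alpha>)) \<le> pi / 12 * exp (2 * pi * t) * exp (- 2 * pi / \<alpha>) ^ nat \<bar>l\<bar>"
proof -
  have "\<bar>of_int l / \<alpha>\<bar> = real (nat \<bar>l\<bar>) * (1 / \<alpha>)" using assms(2) by (simp add: abs_divide)
  then have "real (nat \<bar>l\<bar>) * (1 / \<alpha>) - t \<le> \<bar>\<xi> + of_int l / \<alpha>\<bar>" using assms(1) by linarith
  then have "2 * pi * (real (nat \<bar>l\<bar>) * (1 / \<alpha>) - t) \<le> 2 * pi * \<bar>\<xi> + of_int l / \<alpha>\<bar>"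
    by (intro mult_left_mono) auto
  then have "- (2 * pi) * \<bar>\<xi> + of_int l / \<alpha>\<bar> \<le> 2 * pi * t + real (nat \<bar>l\<bar>) * (- 2 * pi / \<alpha>)"
    by (simp add: algebra_simps)
  then have "exp (- (2 * pi) * \<bar>\<xi> + of_int l / \<alpha>\<bar>) \<le> exp (2 * pi * t) * exp (- 2 * pi / \<alpha>) ^ nat \<bar>l\<bar>"
    unfolding exp_of_nat_mult[symmetric] exp_add[symmetric] by (simp only: exp_le_cancel_iff)
  then have "pi / 12 * exp (- (2 * pi) * \<bar>\<xi> + of_int l / \<alpha>\<bar>)
      \<le> pi / 12 * (exp (2 * pi * t) * exp (- 2 * pi / \<alpha>) ^ nat \<bar>l\<bar>)"
    by (intro mult_left_mono) auto
  from order_trans[OF spectrum_upper this] show ?thesis by (simp only: mult.assoc)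
qed

text \<open>
  The polynomial \<open>u * (1 - u)\<^sup>2\<close> increases up to \<open>u = 1 / 3\<close>. For \<open>\<beta> \<ge> 1\<close> the whole annulus
  has \<open>u \<le> exp (- pi) \<le> 1 / 4\<close>, so the minimum is attained at the outer radius \<open>\<beta>\<close>.
\<close>

lemma spectrum_lower:
  assumes \<beta>: "\<beta> \<ge> 1" and \<xi>: "\<beta> / 2 \<le> \<bar>\<xi>\<bar>" "\<bar>\<xi>\<bar> \<le> \<beta>"
  shows "pi / 12 * (exp (- (2 * pi) * \<beta>) * (1 - exp (- (2 * pi) * \<beta>))\<^sup>2) \<le> cmod (spectrum \<xi>)"
proof -
  define u where "u = exp (- (2 * pi) * \<bar>\<xi>\<bar>)"
  define w where "w = exp (- (2 * pi) * \<beta>)"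
  have w: "0 < w" "w \<le> u" using \<xi> by (auto simp: u_def w_def)
  have u: "u \<le> 1 / 4"
  proof -
    have "pi * 1 \<le> 2 * pi * \<bar>\<xi>\<bar>" using \<beta> \<xi> by (simp add: mult_le_cancel_left)
    then have "exp pi \<le> exp (2 * pi * \<bar>\<xi>\<bar>)" by simp
    moreover have "4 \<le> exp pi" using exp_ge_add_one_self[of pi] pi_gt3 by linarith
    ultimately have "4 \<le> exp (2 * pi * \<bar>\<xi>\<bar>)" by linarith
    then show ?thesis
      unfolding u_def using le_imp_inverse_le[of 4 "exp (2 * pi * \<bar>\<xi>\<bar>)"] by (simp add: exp_minus)
  qed
  have "u * (1 - u)\<^sup>2 - w * (1 - w)\<^sup>2 = (u - w) * (1 - 2 * (u + w) + (u\<^sup>2 + u * w + w\<^sup>2))"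
    by (simp add: power2_eq_square algebra_simps)
  also have "\<dots> \<ge> 0"
    using w u by (intro mult_nonneg_nonneg add_nonneg_nonneg) auto
  finally have "w * (1 - w)\<^sup>2 \<le> u * (1 - u)\<^sup>2" by simp
  then show ?thesis
    unfolding cmod_spectrum u_def[symmetric] w_def[symmetric] by (intro mult_left_mono) auto
qed

definition critical_fun :: "real \<Rightarrow> real" where
  "critical_fun x = 2 * exp (- 2 * pi * (1 / x - 2)) /
       ((1 - exp (- 2 * pi / x)) * (1 - exp (- 2 * pi))\<^sup>2)"

text \<open>
  As \<open>x\<close> grows, the numerator grows and the denominator shrinks.
\<close>

lemma critical_fun_strict_mono:
  assumes "0 < x" "x < y"
  shows "critical_fun x < critical_fun y"
  unfolding critical_fun_def
proof (rule frac_less)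
  have inv: "1 / y < 1 / x" using assms by (simp add: frac_less2)
  then show "2 * exp (- 2 * pi * (1 / x - 2)) < 2 * exp (- 2 * pi * (1 / y - 2))" by simp
  have "- 2 * pi / x \<le> - 2 * pi / y" using mult_left_mono[of "1 / y" "1 / x" "2 * pi"] inv by simp
  then show "(1 - exp (- 2 * pi / y)) * (1 - exp (- 2 * pi))\<^sup>2 \<le> (1 - exp (- 2 * pi / x)) * (1 - exp (- 2 * pi))\<^sup>2"
    by (intro mult_right_mono) auto
  show "0 < (1 - exp (- 2 * pi / y)) * (1 - exp (- 2 * pi))\<^sup>2"
    using assms by (intro mult_pos_pos) auto
qed auto

lemma exp_minus_2pi_le: "exp (- 2 * pi) \<le> 1 / 7"
proof -
  have "7 \<le> exp (2 * pi)" using exp_ge_add_one_self[of "2 * pi"] pi_gt3 by linarith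
  then show ?thesis using le_imp_inverse_le[of 7 "exp (2 * pi)"] by (simp add: exp_minus)
qed

lemma critical_solution: "\<exists>!x. x \<in> {1/3<..<1/2} \<and> critical_eq x"
proof -
  have critical_iff: "critical_eq x \<longleftrightarrow> critical_fun x = 1" for x
    by (simp add: critical_eq_def critical_fun_def)
  have at_third: "critical_fun (1/3) < 1"
  proof -
    have "exp (- 6 * pi) \<le> exp (- 2 * pi)" by simp
    then have "exp (- 6 * pi) \<le> 1 / 7" using exp_minus_2pi_le by linarith
    then have "(1 - 1/7) * (1 - 1/7)\<^sup>2 \<le> (1 - exp (- 6 * pi)) * (1 - exp (- 2 * pi))\<^sup>2"
      using exp_minus_2pi_le by (intro mult_mono power_mono) auto
    then have "2 * exp (- 2 * pi) < (1 - exp (- 6 * pi)) * (1 - exp (- 2 * pi))\<^sup>2"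
      using exp_minus_2pi_le by (simp add: power2_eq_square)
    then show ?thesis by (simp add: critical_fun_def)
  qed
  have at_half: "1 < critical_fun (1/2)"
  proof -
    have "(1 - exp (- 4 * pi)) * (1 - exp (- 2 * pi))\<^sup>2 \<le> 1 * 1\<^sup>2"
      by (intro mult_mono power_mono) auto
    moreover have "(1 - exp (- 4 * pi)) * (1 - exp (- 2 * pi))\<^sup>2 > 0" by simp
    ultimately show ?thesis by (simp add: critical_fun_def)
  qed
  have "continuous_on {1/3..1/2} critical_fun"
    unfolding critical_fun_def[abs_def] by (intro continuous_intros) auto
  then obtain x where x: "1/3 \<le> x" "x \<le> 1/2" "critical_fun x = 1"
    using IVT'[of critical_fun "1/3" 1 "1/2"] at_third at_half by auto
  then have "x \<noteq> 1/3" "x \<noteq> 1/2" using at_third at_half by (metis less_irrefl)+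
  with x have ex: "x \<in> {1/3<..<1/2} \<and> critical_eq x" by (auto simp: critical_iff)
  show ?thesis
  proof (rule ex1I[of _ x])
    show "x \<in> {1/3<..<1/2} \<and> critical_eq x" by (rule ex)
    fix y assume y: "y \<in> {1/3<..<1/2} \<and> critical_eq y"
    then show "y = x"
      using critical_fun_strict_mono[of x y] critical_fun_strict_mono[of y x] x
      by (cases x y rule: linorder_cases) (auto simp: critical_iff)
  qed
qed

lemma a_star: "a_star < 1/2" "critical_fun a_star = 1"
  using theI'[OF critical_solution]
  by (auto simp: a_star_def critical_eq_def critical_fun_def)

text \<open>
  Up to the factor \<open>pi / 12\<close>, the two sides are the sum of the bounds for the translates with
  \<open>l \<noteq> 0\<close> and the minimum of the spectrum on the annulus, where \<open>s = 1 / (\<alpha> * \<beta>)\<close>. For \<open>\<beta> = 1\<close>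
  the inequality is the hypothesis on \<open>critical_fun\<close>. Passing to \<open>\<beta> > 1\<close> helps: both
  \<open>exp (- 2 * pi * \<beta> * (s - 2))\<close>, because \<open>s \<ge> 2\<close>, and the subtracted exponentials decrease.
\<close>

lemma spectrum_dominant:
  assumes \<beta>: "\<beta> \<ge> 1" and s: "s \<ge> 2" and crit: "critical_fun (1 / s) < 1"
  shows "exp (2 * pi * \<beta>) * (2 * (exp (- 2 * pi * (\<beta> * s)) / (1 - exp (- 2 * pi * (\<beta> * s)))))
    < exp (- (2 * pi) * \<beta>) * (1 - exp (- (2 * pi) * \<beta>))\<^sup>2"
proof -
  define r where "r = exp (- 2 * pi * (\<beta> * s))"
  define r1 where "r1 = exp (- 2 * pi * s)"
  have s_le: "s \<le> \<beta> * s" using \<beta> s by simp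
  have "- 2 * pi * (\<beta> * s) \<le> - 2 * pi * s"
    by (rule mult_left_mono_neg[OF s_le]) simp
  then have r: "r \<le> r1" "r1 < 1"
    unfolding r_def r1_def using s by simp_all
  have w: "exp (- (2 * pi) * \<beta>) \<le> exp (- 2 * pi)" using \<beta> by simp
  have cancel: "exp (- (2 * pi) * \<beta>) * (exp (2 * pi * \<beta>) * t) = t" for t
    by (simp add: exp_minus)
  have "2 * exp (- 2 * pi * (s - 2)) < (1 - r1) * (1 - exp (- 2 * pi))\<^sup>2"
  proof -
    have pos: "0 < (1 - r1) * (1 - exp (- 2 * pi))\<^sup>2" using r by simp
    have "critical_fun (1 / s) = 2 * exp (- 2 * pi * (s - 2)) / ((1 - r1) * (1 - exp (- 2 * pi))\<^sup>2)"
      by (simp add: critical_fun_def r1_def)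
    then show ?thesis using crit by (simp only: pos_divide_less_eq[OF pos] mult_1_left)
  qed
  moreover have "exp (- 2 * pi * (\<beta> * (s - 2))) \<le> exp (- 2 * pi * (s - 2))"
  proof -
    have "1 * (s - 2) \<le> \<beta> * (s - 2)" using \<beta> s by (intro mult_right_mono) auto
    then have "- 2 * pi * (\<beta> * (s - 2)) \<le> - 2 * pi * (s - 2)"
      by (intro mult_left_mono_neg) auto
    then show ?thesis by (simp only: exp_le_cancel_iff)
  qed
  moreover have "(1 - r1) * (1 - exp (- 2 * pi))\<^sup>2 \<le> (1 - r) * (1 - exp (- (2 * pi) * \<beta>))\<^sup>2"
    using r w by (intro mult_mono power_mono) auto
  ultimately have "2 * exp (- 2 * pi * (\<beta> * (s - 2))) < (1 - r) * (1 - exp (- (2 * pi) * \<beta>))\<^sup>2"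
    by linarith
  moreover have "exp (- 2 * pi * (\<beta> * (s - 2))) = exp (2 * pi * \<beta>) * exp (2 * pi * \<beta>) * r"
  proof -
    have "- 2 * pi * (\<beta> * (s - 2)) = 2 * pi * \<beta> + 2 * pi * \<beta> + - 2 * pi * (\<beta> * s)"
      by (simp add: algebra_simps)
    then show ?thesis by (simp only: r_def exp_add)
  qed
  ultimately have "exp (2 * pi * \<beta>) * (exp (2 * pi * \<beta>) * (2 * r)) < (1 - r) * (1 - exp (- (2 * pi) * \<beta>))\<^sup>2"
    by (simp only: mult.assoc mult.left_commute[of 2 "exp (2 * pi * \<beta>)"])
  then have "exp (- (2 * pi) * \<beta>) * (exp (2 * pi * \<beta>) * (exp (2 * pi * \<beta>) * (2 * r)))
      < exp (- (2 * pi) * \<beta>) * ((1 - r) * (1 - exp (- (2 * pi) * \<beta>))\<^sup>2)"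
    by (intro mult_strict_left_mono) auto
  then have "exp (2 * pi * \<beta>) * (2 * r) < (exp (- (2 * pi) * \<beta>) * (1 - exp (- (2 * pi) * \<beta>))\<^sup>2) * (1 - r)"
    unfolding cancel by (simp only: mult.assoc mult.commute[of "1 - r"])
  then have "exp (2 * pi * \<beta>) * (2 * r) / (1 - r) < exp (- (2 * pi) * \<beta>) * (1 - exp (- (2 * pi) * \<beta>))\<^sup>2"
    using r by (simp add: pos_divide_less_eq)
  then show ?thesis by (simp add: r_def)
qed

text \<open>
  The majorants \<open>p\<close> and \<open>q\<close> are the geometric bounds on a period, where \<open>\<bar>\<xi>\<bar> \<le> 1 / (2 * \<alpha>)\<close>, and
  on the annulus, where \<open>\<bar>\<xi>\<bar> \<le> \<beta>\<close>.
\<close>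

lemma window_dominant_spectrum:
  assumes \<alpha>: "\<alpha> > 0" and \<beta>: "\<beta> \<ge> 1" and prod: "\<alpha> * \<beta> < a_star"
  shows "dominant_spectrum window spectrum \<alpha> \<beta>
    (pi / 12 * (exp (- (2 * pi) * \<beta>) * (1 - exp (- (2 * pi) * \<beta>))\<^sup>2))
    (\<lambda>l. pi / 12 * exp (2 * pi * (1 / (2 * \<alpha>))) * exp (- 2 * pi / \<alpha>) ^ nat \<bar>l\<bar>)
    (\<lambda>l. pi / 12 * exp (2 * pi * \<beta>) * exp (- 2 * pi / \<alpha>) ^ nat \<bar>l\<bar>)"
proof
  define s where "s = 1 / (\<alpha> * \<beta>)"
  define r where "r = exp (- 2 * pi / \<alpha>)"
  have prod0: "0 < \<alpha> * \<beta>" using \<alpha> \<beta> by simp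
  have half: "\<alpha> * \<beta> < 1/2" using prod a_star(1) by simp
  have s: "s \<ge> 2" using half prod0 by (simp add: s_def field_simps)
  have r: "0 \<le> r" "r < 1" using \<alpha> by (auto simp: r_def)
  have crit: "critical_fun (1 / s) < 1"
    using critical_fun_strict_mono[OF prod0 prod] a_star(2) by (simp add: s_def)
  show "0 < \<alpha>" "0 < \<beta>" using \<alpha> \<beta> by auto
  show "2 * \<beta> \<le> 1 / \<alpha>" using half \<alpha> by (simp add: field_simps)
  show "(\<lambda>l. pi / 12 * exp (2 * pi * (1 / (2 * \<alpha>))) * exp (- 2 * pi / \<alpha>) ^ nat \<bar>l\<bar>) summable_on UNIV"
    unfolding r_def[symmetric] by (intro summable_on_cmult_right summable_on_geometric_int r)
  have q: "((\<lambda>l. pi / 12 * exp (2 * pi * \<beta>) * r ^ nat \<bar>l\<bar>) has_sum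
      (pi / 12 * exp (2 * pi * \<beta>) * (2 * (r / (1 - r))))) (-{0})"
    by (intro has_sum_cmult_right has_sum_geometric_int r)
  then show "(\<lambda>l. pi / 12 * exp (2 * pi * \<beta>) * exp (- 2 * pi / \<alpha>) ^ nat \<bar>l\<bar>) summable_on -{0}"
    unfolding r_def by (rule has_sum_imp_summable)
  have "r = exp (- 2 * pi * (\<beta> * s))" using \<alpha> \<beta> by (simp add: r_def s_def)
  then have "pi / 12 * (exp (2 * pi * \<beta>) * (2 * (r / (1 - r))))
      < pi / 12 * (exp (- (2 * pi) * \<beta>) * (1 - exp (- (2 * pi) * \<beta>))\<^sup>2)"
    using spectrum_dominant[OF \<beta> s crit] by (intro mult_strict_left_mono) auto
  then show "(\<Sum>\<^sub>\<infinity>l\<in>-{0}. pi / 12 * exp (2 * pi * \<beta>) * exp (- 2 * pi / \<alpha>) ^ nat \<bar>l\<bar>)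
      < pi / 12 * (exp (- (2 * pi) * \<beta>) * (1 - exp (- (2 * pi) * \<beta>))\<^sup>2)"
    using infsumI[OF q] by (simp only: r_def mult.assoc)
  show "cmod (spectrum (\<xi> + of_int l / \<alpha>))
      \<le> pi / 12 * exp (2 * pi * (1 / (2 * \<alpha>))) * exp (- 2 * pi / \<alpha>) ^ nat \<bar>l\<bar>"
    if "\<bar>\<xi>\<bar> \<le> 1 / (2 * \<alpha>)" for \<xi> l
    by (rule spectrum_upper_shift[OF that \<alpha>])
  show "cmod (spectrum (\<xi> + of_int l / \<alpha>))
      \<le> pi / 12 * exp (2 * pi * \<beta>) * exp (- 2 * pi / \<alpha>) ^ nat \<bar>l\<bar>"
    if "\<bar>\<xi>\<bar> \<le> \<beta>" for \<xi> l
    by (rule spectrum_upper_shift[OF that \<alpha>])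
  show "pi / 12 * (exp (- (2 * pi) * \<beta>) * (1 - exp (- (2 * pi) * \<beta>))\<^sup>2) \<le> cmod (spectrum \<xi>)"
    if "\<beta> / 2 \<le> \<bar>\<xi>\<bar>" "\<bar>\<xi>\<bar> \<le> \<beta>" for \<xi>
    by (rule spectrum_lower[OF \<beta> that])
qed (fact spectrum_continuous spectrum_integrable window_eq_fourier)+

theorem theorem1p2:
  shows "(\<exists>!x. x \<in> {1/3<..<1/2} \<and> critical_eq x) \<and>
    (\<forall>\<alpha> \<beta>. \<alpha> > 0 \<and> \<beta> > 0 \<and> \<beta> \<ge> 1 \<and> 1/3 \<le> \<alpha> * \<beta> \<and> \<alpha> * \<beta> < a_star \<longrightarrow>
       L2_frame (gabor_system window \<alpha> \<beta>))"
proof (intro conjI allI impI critical_solution)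
  fix \<alpha> \<beta> :: real
  assume "\<alpha> > 0 \<and> \<beta> > 0 \<and> \<beta> \<ge> 1 \<and> 1/3 \<le> \<alpha> * \<beta> \<and> \<alpha> * \<beta> < a_star"
  then have "\<alpha> > 0" "\<beta> \<ge> 1" "\<alpha> * \<beta> < a_star" by auto
  from dominant_spectrum.gabor_frame[OF window_dominant_spectrum[OF this] window_L2 window_continuous]
  show "L2_frame (gabor_system window \<alpha> \<beta>)" .
qed

end
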